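(* For each $\rho$ with $0\le\rho<1/2$, there is a transcendental entire function $f$ of order $\rho$ such that \[ \underline{\Lambda}(\{r>0: A(r,\log|f|)>0\})=\overline{\Lambda}(\{r>0: A(r,\log|f|)>0\})=1-2\rho. \]
   Context: A transcendental entire function is an entire function that is not a polynomial. The order of a transcendental entire function $f$ is \[ \limsup_{r\to\infty}\frac{\log\log M(r,f)}{\log r},\qquad M(r,f)=\max_{|z|=r}|f(z)|. \] For $r>0$, $A(r,\log|f|)=\min_{|z|=r}\log|f(z)|$, with the convention $\log 0=-\infty$. For a (measurable) set $S\subset\mathbb{R}^+$, the upper and lower logarithmic densities of $S$ are \[ \overline{\Lambda}(S)=\limsup_{r\to\infty}\frac{1}{\log r}\int_{S\cap(1,r)}\frac{dt}{t},\qquad \underline{\Lambda}(S)=\liminf_{r\to\infty}\frac{1}{\log r}\int_{S\cap(1,r)}\frac{dt}{t}. \] *)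

theory Defs
  imports "HOL-Complex_Analysis.Complex_Analysis"
begin

definition transcendental_entire :: "(complex \<Rightarrow> complex) \<Rightarrow> bool" where
  "transcendental_entire f \<longleftrightarrow>
     f holomorphic_on UNIV \<and> \<not> (\<exists>p :: complex poly. \<forall>z. f z = poly p z)"

text \<open>
  The supremum is a maximum for continuous \<open>f\<close> and \<open>r \<ge> 0\<close>, since circles are compact.
\<close>

definition max_modulus :: "real \<Rightarrow> (complex \<Rightarrow> complex) \<Rightarrow> real" where
  "max_modulus r f = (SUP z\<in>sphere 0 r. norm (f z))"

text \<open>
  If \<open>f\<close> is entire and not constant then \<open>max_modulus r f\<close> tends to infinity, so both
  logarithms have positive arguments for all large \<open>r\<close>, which is all that matters for the limit
  superior. It is taken in \<^typ>\<open>ereal\<close> because the order may be infinite.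
\<close>

definition growth_order :: "(complex \<Rightarrow> complex) \<Rightarrow> ereal" where
  "growth_order f = Limsup at_top (\<lambda>r. ereal (ln (ln (max_modulus r f)) / ln r))"

text \<open>
  The real \<^const>\<open>ln\<close> satisfies \<open>ln 0 = 0\<close>; here the convention is \<open>log 0 = -\<infinity>\<close>.
\<close>

definition log_abs :: "(complex \<Rightarrow> complex) \<Rightarrow> complex \<Rightarrow> ereal" where
  "log_abs f z = (if f z = 0 then -\<infinity> else ereal (ln (norm (f z))))"

text \<open>
  The infimum is a minimum for \<open>u = log_abs f\<close> with \<open>f\<close> continuous and \<open>r \<ge> 0\<close>, because such
  a \<open>u\<close> is continuous as an extended real valued function.
\<close>

definition min_on_circle :: "real \<Rightarrow> (complex \<Rightarrow> ereal) \<Rightarrow> ereal" where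
  "min_on_circle r u = (INF z\<in>sphere 0 r. u z)"

text \<open>
  Meaningful for measurable \<open>S\<close> only: the integral is \<open>0\<close> by convention if the integrand is not
  integrable. For measurable \<open>S\<close> and \<open>r > 1\<close> the mean lies in \<open>[0, 1]\<close>.
\<close>

definition log_mean :: "real set \<Rightarrow> real \<Rightarrow> real" where
  "log_mean S r = (LINT t : S \<inter> {1<..<r} | lborel. 1 / t) / ln r"

definition upper_log_density :: "real set \<Rightarrow> ereal" where
  "upper_log_density S = Limsup at_top (\<lambda>r. ereal (log_mean S r))"

definition lower_log_density :: "real set \<Rightarrow> ereal" where
  "lower_log_density S = Liminf at_top (\<lambda>r. ereal (log_mean S r))"

end

theory Submission
  imports Defs "HOL-Real_Asymp.Real_Asymp"
begin

text \<open>
  The minimum modulus of an entire function of order \<open>\<rho>\<close> can be kept below \<open>1\<close> most economically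
  by growing only while it is small. A subharmonic function that vanishes on a long slit of the negative
  axis grows like \<open>r powr (1/2)\<close> across that slit, and one that is harmonic in a long annulus needs to
  grow there only logarithmically. If slits fill the fraction \<open>2 \<rho>\<close> of the logarithmic scale, the
  average growth exponent is \<open>2 \<rho> / 2 = \<rho>\<close>, and the minimum modulus is large exactly on the remaining
  fraction \<open>1 - 2 \<rho>\<close>.

  This is realised by a product of polynomials \<open>P k\<close> with \<open>P k 0 = 1\<close>, where the zeros of \<open>P k\<close> lie on
  the \<open>k\<close>-th slit. The slits start at \<open>- exp (k\<^sup>2)\<close> and have logarithmic length \<open>2 \<rho> (2 k + 1)\<close>. Thus the
  periods on the logarithmic scale tend to infinity, which makes bounded or logarithmic errors in them
  negligible, while the quotient of the logarithms of consecutive end points tends to \<open>1\<close>, so that the limits exist and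
  not only the limits along a subsequence.

  For \<open>P k\<close> the Chebyshev polynomial of the slit is taken (\<open>exists_slit_zeros\<close>). Its degree is chosen
  large enough for its smallness on the slit to outweigh the size of the product of the earlier
  polynomials (\<open>degree_dominates\<close>), so the product has modulus at most \<open>1\<close> there
  (\<open>canonical_product_le_1_on_slit\<close>). Because the degree exceeds what is needed for this only by polynomial factors in \<open>k\<close>, the
  polynomial has hardly any influence before its own slit, and between the slits the product of the earlier
  polynomials wins (\<open>canonical_product_gt_1_between_slits\<close>). As all zeros are negative, the minimum
  modulus on a circle is attained on the negative axis, and the logarithmic density can be read off
  (\<open>log_mean_tendsto_of_gaps\<close>). The logarithm of the maximum modulus is comparable to the total degree up
  to polynomial factors in \<open>k\<close>, and this degree is \<open>exp (\<rho> k\<^sup>2)\<close> up to factors of lower order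
  (\<open>growth_order_eq\<close>).
\<close>

section \<open>Chebyshev polynomials of an interval\<close>

text \<open>
  The iterates of \<open>y\<^sup>2 - 2\<close> are the Chebyshev polynomials of degree \<open>2 ^ m\<close>, scaled to the interval
  \<open>[-2, 2]\<close>: in the coordinate \<open>w\<close> with \<open>y = w + 1 / w\<close> each iteration squares \<open>w\<close>. Restricting
  the degrees to powers of two makes all properties of these polynomials provable by doubling,
  without trigonometry.
\<close>

lemma funpow_square_minus_two_eq:
  fixes w :: real
  assumes "w \<noteq> 0"
  shows "((\<lambda>y. y\<^sup>2 - 2) ^^ m) (w + 1 / w) = w ^ 2 ^ m + 1 / w ^ 2 ^ m"
proof (induction m)
  case (Suc m)
  have "((\<lambda>y. y\<^sup>2 - 2) ^^ Suc m) (w + 1 / w) = (w ^ 2 ^ m + 1 / w ^ 2 ^ m)\<^sup>2 - 2"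
    using Suc by simp
  also have "\<dots> = (w ^ 2 ^ m)\<^sup>2 + 1 / (w ^ 2 ^ m)\<^sup>2"
    using assms by (simp add: power2_sum power_divide)
  also have "(w ^ 2 ^ m)\<^sup>2 = w ^ 2 ^ Suc m"
    by (simp add: power_mult [symmetric] mult.commute)
  finally show ?case .
qed auto

lemma funpow_square_minus_two_bounded:
  fixes y :: real
  assumes "\<bar>y\<bar> \<le> 2"
  shows "\<bar>((\<lambda>y. y\<^sup>2 - 2) ^^ m) y\<bar> \<le> 2"
proof (induction m)
  case (Suc m)
  have "(((\<lambda>y. y\<^sup>2 - 2) ^^ m) y)\<^sup>2 \<le> 2\<^sup>2"
    using Suc by (metis abs_ge_zero power2_abs power_mono)
  then show ?case
    by (simp add: abs_le_iff)
qed (use assms in simp)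

text \<open>
  Induction on \<open>m\<close> works for all levels \<open>s\<close> at once, because
  \<open>Y\<^sup>2 - 2 - s = (Y - q) (Y + q)\<close> with \<open>q = sqrt (2 + s)\<close>, and \<open>q\<close> and \<open>- q\<close> are again levels in
  \<open>[-2, 2]\<close>. The sum over the roots is the logarithmic derivative of the polynomial, expressed
  in the coordinate \<open>w\<close>.
\<close>

lemma funpow_square_minus_two_roots:
  fixes s :: real
  assumes "\<bar>s\<bar> \<le> 2"
  shows "\<exists>cs. length cs = 2 ^ m \<and> set cs \<subseteq> {-2..2} \<and>
           (\<forall>y. (\<Prod>c\<leftarrow>cs. y - c) = ((\<lambda>y. y\<^sup>2 - 2) ^^ m) y - s) \<and>
           (\<forall>w>1. (\<Sum>c\<leftarrow>cs. 1 / (w + 1 / w - c)) =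
              2 ^ m * (w ^ 2 ^ m - 1 / w ^ 2 ^ m) /
                ((w - 1 / w) * (w ^ 2 ^ m + 1 / w ^ 2 ^ m - s)))"
  using assms
proof (induction m arbitrary: s)
  case 0
  have "w - 1 / w \<noteq> 0" if "w > 1" for w :: real
    using that by (simp add: field_simps) (metis less_1_mult less_irrefl mult.right_neutral)
  then show ?case
    using 0 by (intro exI [of _ "[s]"]) auto
next
  case (Suc m)
  define q where "q = sqrt (2 + s)"
  have q2: "q\<^sup>2 = 2 + s" and "q \<ge> 0"
    using Suc.prems by (auto simp: q_def)
  have "q \<le> 2"
    using Suc.prems unfolding q_def by (intro real_le_lsqrt) auto
  with \<open>q \<ge> 0\<close> have q: "\<bar>q\<bar> \<le> 2" "\<bar>- q\<bar> \<le> 2"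
    by auto
  obtain cs where cs: "length cs = 2 ^ m" "set cs \<subseteq> {-2..2}"
    "\<And>y. (\<Prod>c\<leftarrow>cs. y - c) = ((\<lambda>y. y\<^sup>2 - 2) ^^ m) y - q"
    "\<And>w. w > 1 \<Longrightarrow> (\<Sum>c\<leftarrow>cs. 1 / (w + 1 / w - c)) =
       2 ^ m * (w ^ 2 ^ m - 1 / w ^ 2 ^ m) / ((w - 1 / w) * (w ^ 2 ^ m + 1 / w ^ 2 ^ m - q))"
    using Suc.IH [OF q(1)] by blast
  obtain ds where ds: "length ds = 2 ^ m" "set ds \<subseteq> {-2..2}"
    "\<And>y. (\<Prod>c\<leftarrow>ds. y - c) = ((\<lambda>y. y\<^sup>2 - 2) ^^ m) y - (- q)"
    "\<And>w. w > 1 \<Longrightarrow> (\<Sum>c\<leftarrow>ds. 1 / (w + 1 / w - c)) =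
       2 ^ m * (w ^ 2 ^ m - 1 / w ^ 2 ^ m) / ((w - 1 / w) * (w ^ 2 ^ m + 1 / w ^ 2 ^ m - (- q)))"
    using Suc.IH [OF q(2)] by blast
  show ?case
  proof (intro exI [of _ "cs @ ds"] conjI allI impI)
    fix y
    show "(\<Prod>c\<leftarrow>cs @ ds. y - c) = ((\<lambda>y. y\<^sup>2 - 2) ^^ Suc m) y - s"
      using q2 by (simp add: cs ds algebra_simps power2_eq_square)
  next
    fix w :: real
    assume w: "w > 1"
    define v where "v = w ^ 2 ^ m"
    have v: "v > 1"
      unfolding v_def using w by simp
    have v2: "w ^ 2 ^ Suc m = v\<^sup>2"
      by (simp add: v_def power_mult [symmetric] mult.commute)
    have w1: "w - 1 / w > 0"
      using w by (simp add: field_simps) (metis less_1_mult mult.right_neutral)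
    have v1: "v + 1 / v > 2"
    proof -
      have "v + 1 / v - 2 = (v - 1)\<^sup>2 / v"
        using v by (simp add: field_simps power2_eq_square)
      moreover have "(v - 1)\<^sup>2 / v > 0"
        using v by simp
      ultimately show ?thesis by linarith
    qed
    have nz: "v + 1 / v - q \<noteq> 0" "v + 1 / v + q \<noteq> 0"
      using v1 q by auto
    have sq: "v\<^sup>2 + 1 / v\<^sup>2 - s = (v + 1 / v - q) * (v + 1 / v + q)"
      using v q2 by (simp add: algebra_simps power2_eq_square)
    have dif: "v\<^sup>2 - 1 / v\<^sup>2 = (v - 1 / v) * (v + 1 / v)"
      using v by (simp add: algebra_simps power2_eq_square)
    have "(\<Sum>c\<leftarrow>cs @ ds. 1 / (w + 1 / w - c)) =
        2 ^ m * (v - 1 / v) / ((w - 1 / w) * (v + 1 / v - q))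
        + 2 ^ m * (v - 1 / v) / ((w - 1 / w) * (v + 1 / v + q))"
      by (simp add: cs(4) [OF w] ds(4) [OF w] v_def)
    also have "\<dots> = 2 ^ m * (v - 1 / v) / (w - 1 / w) * (1 / (v + 1 / v - q) + 1 / (v + 1 / v + q))"
      by (simp add: distrib_left)
    also have "1 / (v + 1 / v - q) + 1 / (v + 1 / v + q)
        = 2 * (v + 1 / v) / ((v + 1 / v - q) * (v + 1 / v + q))"
      using nz by (simp add: add_divide_eq_iff divide_add_eq_iff)
    also have "2 ^ m * (v - 1 / v) / (w - 1 / w)
          * (2 * (v + 1 / v) / ((v + 1 / v - q) * (v + 1 / v + q)))
        = 2 ^ Suc m * (v\<^sup>2 - 1 / v\<^sup>2) / ((w - 1 / w) * (v\<^sup>2 + 1 / v\<^sup>2 - s))"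
      unfolding sq dif by simp
    finally show "(\<Sum>c\<leftarrow>cs @ ds. 1 / (w + 1 / w - c)) =
       2 ^ Suc m * (w ^ 2 ^ Suc m - 1 / w ^ 2 ^ Suc m) /
         ((w - 1 / w) * (w ^ 2 ^ Suc m + 1 / w ^ 2 ^ Suc m - s))"
      unfolding v2 .
  qed (use cs ds in auto)
qed

lemma prod_list_divide:
  fixes f g :: "'a \<Rightarrow> real"
  shows "(\<Prod>x\<leftarrow>xs. f x / g x) = (\<Prod>x\<leftarrow>xs. f x) / (\<Prod>x\<leftarrow>xs. g x)"
  by (induction xs) auto

text \<open>
  The Chebyshev polynomial of the interval \<open>[a, b]\<close>, normalised to be \<open>1\<close> at \<open>0\<close>. Its smallness on
  \<open>[a, b]\<close> is governed by the Green function of the complement of the interval at \<open>0\<close>, which is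
  about \<open>sqrt (a / b)\<close>; so a degree proportional to \<open>sqrt (b / a)\<close> is enough to compensate a given
  bound. At the same time the sum of the inverse zeros stays of order \<open>degree / sqrt (a * b)\<close>, which
  keeps the polynomial close to \<open>1\<close> on discs of radius far below \<open>a\<close>. In the degenerate case
  \<open>a = b\<close> all zeros coincide.
\<close>

lemma exists_slit_zeros:
  fixes a b :: real
  assumes "0 < a" "a \<le> b"
  shows "\<exists>xs. length xs = 2 ^ m \<and> set xs \<subseteq> {a..b} \<and>
           (\<forall>r\<in>{a..b}. \<bar>\<Prod>x\<leftarrow>xs. 1 - r / x\<bar> \<le> 2 * exp (- (2 ^ m * sqrt (a / b)))) \<and>
           (\<Sum>x\<leftarrow>xs. 1 / x) \<le> 2 ^ m / sqrt (a * b)"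
proof (cases "a = b")
  case True
  have "(\<Prod>x\<leftarrow>replicate (2 ^ m) a. 1 - a / x) = 0"
    using assms by (simp add: power_0_left)
  then show ?thesis
    using assms True by (intro exI [of _ "replicate (2 ^ m) a"]) (auto simp: sum_list_replicate power_0_left)
next
  case False
  \<comment> \<open>\<open>y = y0 - 4 r / (b - a)\<close> maps \<open>[a, b]\<close> affinely onto \<open>[-2, 2]\<close> and \<open>0\<close> to \<open>y0 = w + 1 / w\<close>.\<close>
  define y0 where "y0 = 2 * (a + b) / (b - a)"
  define w where "w = (sqrt b + sqrt a) / (sqrt b - sqrt a)"
  define n :: nat where "n = 2 ^ m"
  have ab: "0 < a" "a < b" "sqrt a > 0" "sqrt a < sqrt b"
    using assms False by auto
  have sq: "sqrt a * sqrt a = a" "sqrt b * sqrt b = b"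
    using ab by auto
  have dif: "(sqrt b + sqrt a) * (sqrt b - sqrt a) = b - a"
    using sq by (simp add: algebra_simps)
  have inv: "1 / w = (sqrt b - sqrt a) / (sqrt b + sqrt a)"
    by (simp add: w_def)
  have w_alt: "w = (sqrt b + sqrt a)\<^sup>2 / (b - a)" "1 / w = (sqrt b - sqrt a)\<^sup>2 / (b - a)"
    using ab unfolding inv dif [symmetric] w_def
    by (simp_all add: power2_eq_square)
  have w_plus: "w + 1 / w = y0"
    unfolding w_alt(2) unfolding w_alt(1) y0_def add_divide_distrib [symmetric]
    using sq by (simp add: algebra_simps power2_eq_square)
  have w_minus: "w - 1 / w = 4 * sqrt (a * b) / (b - a)"
    unfolding w_alt(2) unfolding w_alt(1) diff_divide_distrib [symmetric]
    by (simp add: algebra_simps power2_eq_square real_sqrt_mult)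
  have "w > 1"
    unfolding w_def using ab by (simp add: less_divide_eq)
  obtain cs where cs: "length cs = n" "set cs \<subseteq> {-2..2}"
    "\<And>y. (\<Prod>c\<leftarrow>cs. y - c) = ((\<lambda>y. y\<^sup>2 - 2) ^^ m) y"
    "(\<Sum>c\<leftarrow>cs. 1 / (w + 1 / w - c)) = n * (w ^ n - 1 / w ^ n) /
        ((w - 1 / w) * (w ^ n + 1 / w ^ n))"
    using funpow_square_minus_two_roots [of 0 m] \<open>w > 1\<close> unfolding n_def by force
  have y0_gt: "y0 - c > 0" if "c \<in> set cs" for c
  proof -
    have "c \<le> 2" using that cs by auto
    moreover have "y0 > 2"
      using ab by (simp add: y0_def less_divide_eq)
    ultimately show ?thesis by simp
  qed
  \<comment> \<open>\<open>h\<close> is the inverse of that affine map, so it carries the roots to the required zeros.\<close>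
  define h where "h = (\<lambda>c. (b - a) / 4 * (y0 - c))"
  have h: "h c \<in> {a..b}" if "c \<in> set cs" for c
  proof -
    have "c \<le> 2" "c \<ge> -2" using that cs by auto
    moreover have "h c = (a + b) / 2 - (b - a) / 4 * c"
    proof -
      have "d / 4 * (2 * e / d) = e / 2" if "d \<noteq> 0" for d e :: real
        using that by simp
      then have "(b - a) / 4 * y0 = (a + b) / 2"
        unfolding y0_def using ab by (metis less_irrefl right_minus_eq)
      then show ?thesis
        by (simp only: h_def right_diff_distrib)
    qed
    moreover have "(b - a) / 4 * c \<le> (b - a) / 4 * 2" "(b - a) / 4 * c \<ge> (b - a) / 4 * -2"
      using ab calculation by (intro mult_left_mono; simp)+
    ultimately show ?thesis by (simp add: field_simps)
  qed
  have wn: "w ^ n > 0" "1 / w ^ n > 0"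
    using \<open>w > 1\<close> by auto
  have exp_le: "exp (n * sqrt (a / b)) \<le> w ^ n"
  proof -
    define q where "q = sqrt (a / b)"
    have q: "0 < q" "q < 1"
      using ab by (auto simp: q_def)
    have "exp q = 1 / exp (- q)"
      by (simp add: exp_minus field_simps)
    also have "\<dots> \<le> 1 / (1 - q)"
      using q exp_ge_add_one_self [of "- q"] by (intro divide_left_mono) auto
    also have "\<dots> \<le> (1 + q) / (1 - q)"
      using q by (intro divide_right_mono) auto
    also have "\<dots> = w"
    proof -
      have "1 + q = (sqrt b + sqrt a) / sqrt b" "1 - q = (sqrt b - sqrt a) / sqrt b"
        using ab by (simp_all add: q_def real_sqrt_divide add_divide_distrib diff_divide_distrib)
      then show ?thesis
        using ab by (simp add: w_def)
    qed
    finally have "exp q ^ n \<le> w ^ n"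
      by (intro power_mono) auto
    then show ?thesis
      by (simp add: q_def exp_of_nat_mult)
  qed
  have bound: "\<bar>\<Prod>x\<leftarrow>map h cs. 1 - r / x\<bar> \<le> 2 * exp (- (n * sqrt (a / b)))"
    if r: "r \<in> {a..b}" for r
  proof -
    define y where "y = y0 - 4 * r / (b - a)"
    have "y = 2 - 4 * ((r - a) / (b - a))"
    proof -
      have "2 - 4 * (r - a) / (b - a) = (2 * (b - a) - 4 * (r - a)) / (b - a)"
        using ab nonzero_mult_div_cancel_right [of "b - a" 2] by (simp only: diff_divide_distrib)
      also have "\<dots> = (2 * (a + b) - 4 * r) / (b - a)"
        by (simp add: algebra_simps)
      finally show ?thesis
        unfolding y_def y0_def diff_divide_distrib [of "2 * (a + b)"] by simp
    qed
    moreover have "0 \<le> (r - a) / (b - a)" "(r - a) / (b - a) \<le> 1"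
      using ab r by auto
    ultimately have y: "\<bar>y\<bar> \<le> 2"
      unfolding abs_le_iff by linarith
    have fac: "1 - r / h c = (y - c) / (y0 - c)" if "c \<in> set cs" for c
    proof -
      have "r / h c = (4 * r / (b - a)) / (y0 - c)"
        by (simp add: h_def)
      moreover have "1 = (y0 - c) / (y0 - c)"
        using y0_gt [OF that] by simp
      ultimately have "1 - r / h c = (y0 - c - 4 * r / (b - a)) / (y0 - c)"
        by (metis diff_divide_distrib)
      then show ?thesis by (simp add: y_def algebra_simps)
    qed
    have "(\<Prod>x\<leftarrow>map h cs. 1 - r / x) = (\<Prod>c\<leftarrow>cs. (y - c) / (y0 - c))"
      by (simp add: comp_def fac cong: map_cong)
    also have "\<dots> = ((\<lambda>y. y\<^sup>2 - 2) ^^ m) y / (w ^ n + 1 / w ^ n)"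
      using \<open>w > 1\<close> funpow_square_minus_two_eq [of w m]
      by (simp add: prod_list_divide cs(3) flip: w_plus n_def)
    finally have "\<bar>\<Prod>x\<leftarrow>map h cs. 1 - r / x\<bar>
        = \<bar>((\<lambda>y. y\<^sup>2 - 2) ^^ m) y\<bar> / (w ^ n + 1 / w ^ n)"
      using wn by (simp add: abs_mult)
    also have "\<dots> \<le> 2 / w ^ n"
      using funpow_square_minus_two_bounded [OF y, of m] wn by (intro frac_le) auto
    also have "\<dots> \<le> 2 / exp (n * sqrt (a / b))"
      using exp_le by (intro divide_left_mono) (auto simp: wn)
    finally show ?thesis
      by (simp add: exp_minus field_simps)
  qed
  have "(\<Sum>x\<leftarrow>map h cs. 1 / x) = (\<Sum>c\<leftarrow>cs. 1 / (w + 1 / w - c) * (4 / (b - a)))"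
    by (simp add: comp_def h_def w_plus mult.commute)
  also have "\<dots> = n * ((w ^ n - 1 / w ^ n) / (w ^ n + 1 / w ^ n)) / (w - 1 / w) * (4 / (b - a))"
    unfolding sum_list_mult_const cs(4) by simp
  also have "(w ^ n - 1 / w ^ n) / (w ^ n + 1 / w ^ n) \<le> 1"
    using wn by (subst divide_le_eq_1_pos) (auto intro: add_pos_pos)
  then have "n * ((w ^ n - 1 / w ^ n) / (w ^ n + 1 / w ^ n)) \<le> real n * 1"
    by (rule mult_left_mono) simp
  then have "n * ((w ^ n - 1 / w ^ n) / (w ^ n + 1 / w ^ n)) / (w - 1 / w) * (4 / (b - a))
      \<le> real n * 1 / (w - 1 / w) * (4 / (b - a))"
    using ab by (intro mult_right_mono divide_right_mono) (auto simp: w_minus)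
  also have "\<dots> = n / sqrt (a * b)"
    using ab by (simp add: w_minus)
  finally have "(\<Sum>x\<leftarrow>map h cs. 1 / x) \<le> n / sqrt (a * b)" .
  then show ?thesis
    using bound h cs(1) by (intro exI [of _ "map h cs"]) (auto simp: n_def)
qed

section \<open>Canonical products with negative zeros\<close>

lemma norm_prod_list_minus_one_le:
  fixes f :: "'a \<Rightarrow> complex"
  shows "norm ((\<Prod>x\<leftarrow>xs. 1 + f x) - 1) \<le> exp (\<Sum>x\<leftarrow>xs. norm (f x)) - 1"
proof (induction xs)
  case (Cons y ys)
  define p where "p = (\<Prod>x\<leftarrow>ys. 1 + f x)"
  define e where "e = (\<Sum>x\<leftarrow>ys. norm (f x))"
  have IH: "norm (p - 1) \<le> exp e - 1"
    using Cons by (simp add: p_def e_def)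
  have "norm ((1 + f y) * p - 1) = norm ((1 + f y) * (p - 1) + f y)"
    by (simp add: algebra_simps)
  also have "\<dots> \<le> (1 + norm (f y)) * (exp e - 1) + norm (f y)"
    using IH norm_triangle_ineq [of 1 "f y"]
    by (intro order.trans [OF norm_triangle_ineq] add_mono)
      (auto simp: norm_mult intro!: mult_mono)
  also have "\<dots> = (1 + norm (f y)) * exp e - 1"
    by (simp add: algebra_simps)
  also have "\<dots> \<le> exp (norm (f y)) * exp e - 1"
    by (intro diff_right_mono mult_right_mono exp_ge_add_one_self) auto
  finally show ?case
    by (simp add: p_def e_def exp_add)
qed auto

lemma norm_prod_list:
  fixes f :: "'a \<Rightarrow> 'b :: real_normed_field"
  shows "norm (\<Prod>x\<leftarrow>xs. f x) = (\<Prod>x\<leftarrow>xs. norm (f x))"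
  by (induction xs) (auto simp: norm_mult)

lemma norm_prod_list_mono:
  fixes f :: "'a \<Rightarrow> 'b :: real_normed_field" and g :: "'a \<Rightarrow> 'c :: real_normed_field"
  assumes "\<And>x. x \<in> set xs \<Longrightarrow> norm (f x) \<le> norm (g x)"
  shows "norm (\<Prod>x\<leftarrow>xs. f x) \<le> norm (\<Prod>x\<leftarrow>xs. g x)"
  using assms by (induction xs) (auto simp: norm_mult intro!: mult_mono)

lemma prod_list_le_power:
  fixes f :: "'a \<Rightarrow> real"
  assumes "\<And>x. x \<in> set xs \<Longrightarrow> 0 \<le> f x \<and> f x \<le> c"
  shows "(\<Prod>x\<leftarrow>xs. f x) \<le> c ^ length xs"
proof -
  have "0 \<le> (\<Prod>x\<leftarrow>xs. f x) \<and> (\<Prod>x\<leftarrow>xs. f x) \<le> c ^ length xs"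
    using assms by (induction xs) (auto intro!: mult_mono intro: order.trans)
  then show ?thesis ..
qed

lemma power_le_prod_list:
  fixes f :: "'a \<Rightarrow> real"
  assumes "\<And>x. x \<in> set xs \<Longrightarrow> c \<le> f x" "0 \<le> c"
  shows "c ^ length xs \<le> (\<Prod>x\<leftarrow>xs. f x)"
proof -
  have "0 \<le> (\<Prod>x\<leftarrow>xs. f x) \<and> c ^ length xs \<le> (\<Prod>x\<leftarrow>xs. f x)"
    using assms by (induction xs) (auto intro!: mult_mono mult_nonneg_nonneg intro: order.trans)
  then show ?thesis ..
qed

lemma abs_prod_list:
  fixes f :: "'a \<Rightarrow> real" shows "\<bar>\<Prod>x\<leftarrow>xs. f x\<bar> = (\<Prod>x\<leftarrow>xs. \<bar>f x\<bar>)"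
  using norm_prod_list [of f xs] by simp

lemma of_real_prod_list:
  "of_real (\<Prod>x\<leftarrow>xs. f x) = (\<Prod>x\<leftarrow>xs. of_real (f x) :: complex)"
  by (induction xs) auto

lemma exp_minus_double_le_one_minus:
  fixes x :: real
  assumes "0 \<le> x" "x \<le> 1 / 2"
  shows "exp (- (2 * x)) \<le> 1 - x"
proof -
  have "x * x \<le> x * (1 / 2)"
    using assms by (intro mult_left_mono) auto
  then have "- (2 * x) \<le> - x - 2 * x\<^sup>2"
    by (simp add: power2_eq_square)
  also have "\<dots> \<le> ln (1 - x)"
    using assms by (rule ln_one_minus_pos_lower_bound)
  finally show ?thesis
    using assms by (simp add: ln_ge_iff)
qed

text \<open>
  Canonical products of genus zero whose zeros are all negative. The zeros \<open>- x\<close> come in finite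
  groups \<open>X k\<close>, and a list allows multiplicities.
\<close>

locale negative_zeros =
  fixes X :: "nat \<Rightarrow> real list"
  assumes zeros_pos: "\<And>k x. x \<in> set (X k) \<Longrightarrow> 0 < x"
    and summable_inverses: "summable (\<lambda>k. \<Sum>x\<leftarrow>X k. 1 / x)"
begin

definition factor :: "nat \<Rightarrow> complex \<Rightarrow> complex" where
  "factor k z = (\<Prod>x\<leftarrow>X k. 1 + z / of_real x)"

definition canonical_product :: "complex \<Rightarrow> complex" where
  "canonical_product z = lim (\<lambda>n. \<Prod>k<n. factor k z)"

definition inverse_sum :: "nat \<Rightarrow> real" where
  "inverse_sum k = (\<Sum>x\<leftarrow>X k. 1 / x)"

definition inverse_tail :: "nat \<Rightarrow> real" where
  "inverse_tail n = (\<Sum>k. inverse_sum (k + n))"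

lemma inverse_sum_nonneg: "0 \<le> inverse_sum k"
  unfolding inverse_sum_def using zeros_pos by (intro sum_list_nonneg) (auto simp: less_imp_le)

lemma summable_inverse_sum: "summable inverse_sum"
  using summable_inverses by (simp add: inverse_sum_def [abs_def])

lemma sum_inverse_le_tail:
  "(\<Sum>k=n..<N. inverse_sum k) \<le> inverse_tail n"
proof (cases "n \<le> N")
  case True
  have "(\<Sum>k=n..<N. inverse_sum k) = (\<Sum>k<N - n. inverse_sum (k + n))"
    using True sum.shift_bounds_nat_ivl [of inverse_sum 0 n "N - n"] by (simp add: atLeast0LessThan)
  also have "\<dots> \<le> inverse_tail n"
    unfolding inverse_tail_def
    by (intro sum_le_suminf summable_ignore_initial_segment summable_inverse_sum)
      (auto simp: inverse_sum_nonneg)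
  finally show ?thesis .
next
  case False
  then show ?thesis
    unfolding inverse_tail_def
    by (simp add: suminf_nonneg summable_ignore_initial_segment summable_inverse_sum inverse_sum_nonneg)
qed

text \<open>
  This is what makes the product converge: it is locally uniformly dominated by the summable
  sequence of inverse sums.
\<close>

lemma norm_factor_minus_one_le: "norm (factor k z - 1) \<le> exp (norm z * inverse_sum k) - 1"
proof -
  have "(\<Sum>x\<leftarrow>X k. norm (z / of_real x)) = norm z * inverse_sum k"
    using zeros_pos unfolding inverse_sum_def sum_list_const_mult [symmetric]
    by (intro arg_cong [where f = sum_list] map_cong) (auto simp: norm_divide abs_of_pos)
  then show ?thesis
    using norm_prod_list_minus_one_le [of "\<lambda>x. z / of_real x" "X k"] by (simp add: factor_def)
qed

lemma holomorphic_factor: "factor k holomorphic_on A"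
proof -
  have "(\<lambda>z. \<Prod>x\<leftarrow>xs. 1 + z / complex_of_real x) holomorphic_on A"
    if "\<And>x. x \<in> set xs \<Longrightarrow> x > 0" for xs
    using that
  proof (induction xs)
    case (Cons y ys)
    have "y \<noteq> 0"
      using Cons.prems [of y] by simp
    moreover have "(\<lambda>z. \<Prod>x\<leftarrow>ys. 1 + z / complex_of_real x) holomorphic_on A"
      using Cons.IH Cons.prems by simp
    ultimately show ?case
      by (auto intro!: holomorphic_intros)
  qed auto
  then show ?thesis
    using zeros_pos by (simp add: factor_def [abs_def])
qed

lemma uniform_limit_canonical_product:
  "uniform_limit (cball 0 R) (\<lambda>n z. \<Prod>k<n. factor k z) canonical_product sequentially"
proof -
  have bound: "norm (norm (factor k z - 1))
      \<le> exp (R * inverse_tail 0) * R * inverse_sum k" if "z \<in> cball 0 R" for k z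
  proof -
    define t where "t = norm z * inverse_sum k"
    have R: "0 \<le> R" "norm z \<le> R"
      using that by (auto intro: order.trans [OF norm_ge_zero])
    have t: "0 \<le> t" "t \<le> R * inverse_sum k"
      using R inverse_sum_nonneg [of k] by (auto simp: t_def intro: mult_right_mono)
    have "inverse_sum k \<le> inverse_tail 0"
      using member_le_sum [of k "{0..<Suc k}" inverse_sum] inverse_sum_nonneg
      by (intro order.trans [OF _ sum_inverse_le_tail [of 0 "Suc k"]]) auto
    then have tR: "t \<le> R * inverse_tail 0"
      using t R by (meson mult_left_mono order.trans)
    have "1 - t \<le> exp (- t)"
      using exp_ge_add_one_self [of "- t"] by simp
    then have "exp t * (1 - t) \<le> 1"
      by (simp add: exp_minus field_simps)
    then have "exp t - 1 \<le> exp t * t"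
      by (simp add: algebra_simps)
    also have "\<dots> \<le> exp (R * inverse_tail 0) * (R * inverse_sum k)"
      using t tR by (intro mult_mono) auto
    finally show ?thesis
      using norm_factor_minus_one_le [of k z] by (simp add: t_def mult.assoc)
  qed
  have "uniformly_convergent_on (cball 0 R) (\<lambda>N z. \<Prod>n<N. factor n z)"
  proof (rule uniformly_convergent_on_prod')
    show "uniformly_convergent_on (cball 0 R) (\<lambda>N z. \<Sum>n<N. norm (factor n z - 1))"
      using bound summable_inverse_sum
      by (intro Weierstrass_m_test' [where M = "\<lambda>k. exp (R * inverse_tail 0) * R * inverse_sum k"]
          summable_mult) auto
  qed (auto intro!: holomorphic_on_imp_continuous_on holomorphic_factor)
  then show ?thesis
    by (simp add: uniformly_convergent_uniform_limit_iff canonical_product_def [abs_def])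
qed

lemma tendsto_canonical_product:
  "(\<lambda>n. \<Prod>k<n. factor k z) \<longlonglongrightarrow> canonical_product z"
  by (rule tendsto_uniform_limitI [OF uniform_limit_canonical_product [of "norm z"]]) simp

lemma holomorphic_canonical_product: "canonical_product holomorphic_on UNIV"
proof (rule holomorphic_uniform_sequence)
  fix n
  show "(\<lambda>z. \<Prod>k<n. factor k z) holomorphic_on UNIV"
    by (intro holomorphic_intros holomorphic_factor)
next
  fix z :: complex
  have "uniform_limit (cball z 1) (\<lambda>n z. \<Prod>k<n. factor k z) canonical_product sequentially"
    by (rule uniform_limit_on_subset [OF uniform_limit_canonical_product [of "norm z + 1"]])
      (simp add: cball_subset_cball_iff)
  then show "\<exists>d>0. cball z d \<subseteq> UNIV \<and>
      uniform_limit (cball z d) (\<lambda>n z. \<Prod>k<n. factor k z) canonical_product sequentially"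
    by (intro exI [of _ 1]) auto
qed auto

text \<open>
  Since all zeros are negative, each linear factor on the circle of radius \<open>r\<close> has its largest
  modulus at \<open>r\<close> and its smallest at \<open>- r\<close>. Comparing factor by factor therefore locates both the
  maximum and the minimum modulus of the product on the real axis.
\<close>

lemma norm_canonical_product_mono:
  assumes "\<And>k x. x \<in> set (X k) \<Longrightarrow> norm (1 + y / of_real x) \<le> norm (1 + z / of_real x)"
  shows "norm (canonical_product y) \<le> norm (canonical_product z)"
proof (rule LIMSEQ_le)
  show "(\<lambda>n. norm (\<Prod>k<n. factor k y)) \<longlonglongrightarrow> norm (canonical_product y)"
    "(\<lambda>n. norm (\<Prod>k<n. factor k z)) \<longlonglongrightarrow> norm (canonical_product z)"
    by (intro tendsto_norm tendsto_canonical_product)+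
  have "norm (factor k y) \<le> norm (factor k z)" for k
    unfolding factor_def by (intro norm_prod_list_mono assms)
  then show "\<exists>N. \<forall>n\<ge>N. norm (\<Prod>k<n. factor k y) \<le> norm (\<Prod>k<n. factor k z)"
    by (auto simp: prod_norm [symmetric] intro!: prod_mono)
qed

lemma norm_canonical_product_le:
  "norm (canonical_product z) \<le> norm (canonical_product (of_real (norm z)))"
proof (rule norm_canonical_product_mono)
  fix k x assume "x \<in> set (X k)"
  then have x: "x > 0" by (rule zeros_pos)
  have "norm (1 + z / of_real x) \<le> 1 + norm z / x"
    using x by (intro order.trans [OF norm_triangle_ineq]) (simp add: norm_divide)
  also have "\<dots> = norm (of_real (1 + norm z / x) :: complex)"
    unfolding norm_of_real using x by simp
  also have "of_real (1 + norm z / x) = 1 + of_real (norm z) / (of_real x :: complex)"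
    by simp
  finally show "norm (1 + z / of_real x) \<le> norm (1 + of_real (norm z) / complex_of_real x)" .
qed

lemma norm_canonical_product_ge:
  "norm (canonical_product (- of_real (norm z))) \<le> norm (canonical_product z)"
proof (rule norm_canonical_product_mono)
  fix k x assume "x \<in> set (X k)"
  then have x: "x > 0" by (rule zeros_pos)
  have "1 + - of_real (norm z) / (of_real x :: complex) = of_real (1 - norm z / x)"
    by simp
  then have "norm (1 + - of_real (norm z) / complex_of_real x) = \<bar>1 - norm z / x\<bar>"
    by (metis norm_of_real)
  also have "\<dots> = \<bar>norm (1 :: complex) - norm (- (z / of_real x))\<bar>"
    using x by (simp add: norm_divide)
  also have "\<dots> \<le> norm (1 - - (z / of_real x))"
    by (rule norm_triangle_ineq3)
  finally show "norm (1 + - of_real (norm z) / complex_of_real x) \<le> norm (1 + z / of_real x)"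
    by simp
qed

lemma max_modulus_canonical_product:
  assumes "r \<ge> 0"
  shows "max_modulus r canonical_product = norm (canonical_product (of_real r))"
  unfolding max_modulus_def
proof (rule cSup_eq_maximum)
  show "norm (canonical_product (of_real r)) \<in> (\<lambda>z. norm (canonical_product z)) ` sphere 0 r"
    using assms by auto
qed (use norm_canonical_product_le in auto)

lemma min_on_circle_canonical_product_pos_iff:
  assumes "r \<ge> 0"
  shows "min_on_circle r (log_abs canonical_product) > 0 \<longleftrightarrow>
           norm (canonical_product (- of_real r)) > 1"
proof -
  have mono: "log_abs canonical_product y \<le> log_abs canonical_product z"
    if "norm (canonical_product y) \<le> norm (canonical_product z)" for y z
    using that by (auto simp: log_abs_def)
  have "min_on_circle r (log_abs canonical_product) = log_abs canonical_product (- of_real r)"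
    unfolding min_on_circle_def
  proof (rule antisym)
    show "(INF z\<in>sphere 0 r. log_abs canonical_product z) \<le> log_abs canonical_product (- of_real r)"
      using assms by (intro INF_lower) auto
    show "log_abs canonical_product (- of_real r) \<le> (INF z\<in>sphere 0 r. log_abs canonical_product z)"
    proof (rule INF_greatest)
      fix z :: complex assume "z \<in> sphere 0 r"
      then show "log_abs canonical_product (- of_real r) \<le> log_abs canonical_product z"
        using norm_canonical_product_ge [of z] by (intro mono) auto
    qed
  qed
  then show ?thesis
    by (auto simp: log_abs_def zero_ereal_def)
qed

text \<open>
  This gives the measurability without which the logarithmic density has no meaning.
\<close>

lemma open_large_minimum_modulus:
  "open {r. r > 0 \<and> norm (canonical_product (- of_real r)) > 1}"
proof -
  have "continuous_on UNIV canonical_product"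
    by (intro holomorphic_on_imp_continuous_on holomorphic_canonical_product)
  then have "continuous_on UNIV (\<lambda>r :: real. canonical_product (- of_real r))"
    by (rule continuous_on_compose2) (auto intro!: continuous_intros)
  then show ?thesis
    by (intro open_Collect_conj open_Collect_less continuous_on_norm continuous_on_const
        continuous_on_id)
qed

lemma norm_factor_of_real: "norm (factor k (of_real r)) = (\<Prod>x\<leftarrow>X k. \<bar>1 + r / x\<bar>)"
proof -
  have "factor k (of_real r) = of_real (\<Prod>x\<leftarrow>X k. 1 + r / x)"
    unfolding factor_def of_real_prod_list by simp
  then show ?thesis
    by (metis abs_prod_list norm_of_real)
qed

lemma norm_factor_minus_of_real: "norm (factor k (- of_real r)) = (\<Prod>x\<leftarrow>X k. \<bar>1 - r / x\<bar>)"
  using norm_factor_of_real [of k "- r"] by simp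

text \<open>
  The product is split into an initial part, estimated by hand, and a remainder all of whose
  zeros are far away, so that it is controlled by the tail of the inverse sums alone.
\<close>

lemma norm_canonical_product_upper:
  assumes "norm (\<Prod>k<n. factor k z) \<le> c"
    and "\<And>k. k \<ge> n \<Longrightarrow> norm (factor k z) \<le> exp (d * inverse_sum k)"
    and "d \<ge> 0"
  shows "norm (canonical_product z) \<le> c * exp (d * inverse_tail n)"
proof (rule LIMSEQ_le_const2 [OF tendsto_norm [OF tendsto_canonical_product]])
  have "norm (\<Prod>k<N. factor k z) \<le> c * exp (d * inverse_tail n)" if "N \<ge> n" for N
  proof -
    have "(\<Prod>k<N. factor k z) = (\<Prod>k<n. factor k z) * (\<Prod>k=n..<N. factor k z)"
      using prod.atLeastLessThan_concat [of 0 n N "\<lambda>k. factor k z"] that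
      by (simp add: atLeast0LessThan)
    also have "norm \<dots> \<le> c * (\<Prod>k=n..<N. exp (d * inverse_sum k))"
      unfolding norm_mult using assms(1) order.trans [OF norm_ge_zero assms(1)] assms(2)
      by (intro mult_mono) (auto simp: prod_norm [symmetric] intro!: prod_mono prod_nonneg)
    also have "(\<Prod>k=n..<N. exp (d * inverse_sum k)) = exp (d * (\<Sum>k=n..<N. inverse_sum k))"
      by (simp add: exp_sum sum_distrib_left)
    also have "c * \<dots> \<le> c * exp (d * inverse_tail n)"
      using sum_inverse_le_tail assms order.trans [OF norm_ge_zero assms(1)]
      by (auto intro!: mult_left_mono)
    finally show ?thesis .
  qed
  then show "\<exists>N. \<forall>m\<ge>N. norm (\<Prod>k<m. factor k z) \<le> c * exp (d * inverse_tail n)"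
    by blast
qed

lemma norm_canonical_product_lower:
  assumes "c \<le> norm (\<Prod>k<n. factor k z)" "c \<ge> 0"
    and "\<And>k. k \<ge> n \<Longrightarrow> exp (- (d * inverse_sum k)) \<le> norm (factor k z)"
    and "d \<ge> 0"
  shows "c * exp (- (d * inverse_tail n)) \<le> norm (canonical_product z)"
proof (rule LIMSEQ_le_const [OF tendsto_norm [OF tendsto_canonical_product]])
  have "c * exp (- (d * inverse_tail n)) \<le> norm (\<Prod>k<N. factor k z)" if "N \<ge> n" for N
  proof -
    have "c * exp (- (d * inverse_tail n)) \<le> c * exp (- (d * (\<Sum>k=n..<N. inverse_sum k)))"
      using sum_inverse_le_tail assms by (auto intro!: mult_left_mono)
    also have "exp (- (d * (\<Sum>k=n..<N. inverse_sum k)))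
        = (\<Prod>k=n..<N. exp (- (d * inverse_sum k)))"
      by (simp add: exp_sum sum_distrib_left flip: sum_negf)
    also have "c * \<dots> \<le> norm ((\<Prod>k<n. factor k z) * (\<Prod>k=n..<N. factor k z))"
      unfolding norm_mult using assms
      by (intro mult_mono) (auto simp: prod_norm [symmetric] intro!: prod_mono prod_nonneg)
    also have "(\<Prod>k<n. factor k z) * (\<Prod>k=n..<N. factor k z) = (\<Prod>k<N. factor k z)"
      using prod.atLeastLessThan_concat [of 0 n N "\<lambda>k. factor k z"] that
      by (simp add: atLeast0LessThan)
    finally show ?thesis .
  qed
  then show "\<exists>N. \<forall>m\<ge>N. c * exp (- (d * inverse_tail n)) \<le> norm (\<Prod>k<m. factor k z)"
    by blast
qed

lemma exp_le_norm_factor_minus: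
  assumes "r \<ge> 0" "\<And>x. x \<in> set (X k) \<Longrightarrow> 2 * r \<le> x"
  shows "exp (- (2 * r * inverse_sum k)) \<le> norm (factor k (- of_real r))"
proof -
  have "exp (- (2 * r * (\<Sum>x\<leftarrow>xs. 1 / x))) \<le> (\<Prod>x\<leftarrow>xs. \<bar>1 - r / x\<bar>)"
    if "\<And>x. x \<in> set xs \<Longrightarrow> 0 < x \<and> 2 * r \<le> x" for xs
    using that
  proof (induction xs)
    case (Cons y ys)
    have y: "0 < y" "2 * r \<le> y" using Cons.prems by auto
    have "exp (- (2 * (r / y))) \<le> 1 - r / y"
      using y assms by (intro exp_minus_double_le_one_minus) (auto simp: field_simps)
    also have "\<dots> \<le> \<bar>1 - r / y\<bar>" by simp
    finally have "exp (- (2 * (r / y))) * exp (- (2 * r * (\<Sum>x\<leftarrow>ys. 1 / x)))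
        \<le> \<bar>1 - r / y\<bar> * (\<Prod>x\<leftarrow>ys. \<bar>1 - r / x\<bar>)"
      using Cons by (intro mult_mono) auto
    then show ?case
      by (simp add: exp_add [symmetric] algebra_simps)
  qed auto
  then show ?thesis
    using assms zeros_pos by (simp add: norm_factor_minus_of_real inverse_sum_def)
qed

lemma norm_factor_le_exp: "norm (factor k z) \<le> exp (norm z * inverse_sum k)"
  using norm_factor_minus_one_le [of k z] norm_triangle_ineq2 [of "factor k z" 1] by simp

lemma canonical_product_0: "canonical_product 0 = 1"
proof -
  have "factor k 0 = 1" for k
    by (simp add: factor_def map_replicate_const)
  then show ?thesis
    using tendsto_canonical_product [of 0] LIMSEQ_unique [OF _ tendsto_const] by auto
qed

lemma canonical_product_zero:
  assumes "x \<in> set (X k)"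
  shows "canonical_product (- of_real x) = 0"
proof -
  have "factor k (- of_real x) = 0"
    using assms zeros_pos [OF assms] unfolding factor_def prod_list_zero_iff
    by (force intro: rev_image_eqI)
  then have "(\<Prod>j<n. factor j (- of_real x)) = 0" if "n > k" for n
    using that by (intro prod_zero) auto
  then have "(\<lambda>n. \<Prod>j<n. factor j (- of_real x)) \<longlonglongrightarrow> 0"
    by (intro tendsto_eventually eventually_sequentiallyI [of "Suc k"]) auto
  then show ?thesis
    using tendsto_canonical_product LIMSEQ_unique by blast
qed

lemma transcendental_canonical_product:
  assumes "\<And>B. \<exists>k. \<exists>x\<in>set (X k). B < x"
  shows "transcendental_entire canonical_product"
  unfolding transcendental_entire_def
proof (intro conjI holomorphic_canonical_product notI)
  assume "\<exists>p. \<forall>z. canonical_product z = poly p z"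
  then obtain p where p: "\<And>z. canonical_product z = poly p z" by blast
  then have "p \<noteq> 0"
    using canonical_product_0 by force
  then have "bounded (norm ` {z. poly p z = 0})"
    by (intro finite_imp_bounded finite_imageI poly_roots_finite)
  then obtain B where B: "\<And>z. poly p z = 0 \<Longrightarrow> norm z \<le> B"
    unfolding bounded_iff by auto
  obtain k x where x: "x \<in> set (X k)" "B < x"
    using assms by blast
  then have "norm (- complex_of_real x) \<le> B"
    using canonical_product_zero [of x k] by (intro B) (simp flip: p)
  then show False
    using x zeros_pos [of x k] by simp
qed

end

section \<open>Logarithmic means\<close>

text \<open>
  With the sample points \<open>exp (k\<^sup>2)\<close> the logarithms of consecutive points have quotient tending to
  \<open>1\<close>, so quotients by \<open>ln r\<close> may be estimated crudely between two sample points.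
\<close>

lemma tendsto_at_top_sampled:
  fixes F :: "real \<Rightarrow> real" and l u :: "nat \<Rightarrow> real"
  assumes "l \<longlonglongrightarrow> L" "u \<longlonglongrightarrow> L"
    and bounds: "\<And>k r. \<lbrakk>k \<ge> K; exp (real k ^ 2) \<le> r; r \<le> exp (real (Suc k) ^ 2)\<rbrakk> \<Longrightarrow> l k \<le> F r \<and> F r \<le> u k"
  shows "(F \<longlongrightarrow> L) at_top"
proof -
  define index where "index r = nat \<lfloor>sqrt (ln r)\<rfloor>" for r
  have "filterlim index sequentially at_top"
    unfolding index_def
    by (intro filterlim_compose [OF filterlim_nat_sequentially]
        filterlim_compose [OF filterlim_floor_sequentially]
        filterlim_compose [OF sqrt_at_top] ln_at_top)
  have lim: "((\<lambda>r. l (index r)) \<longlongrightarrow> L) at_top" "((\<lambda>r. u (index r)) \<longlongrightarrow> L) at_top"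
    by (rule filterlim_compose [OF assms(1) \<open>filterlim index sequentially at_top\<close>]
        filterlim_compose [OF assms(2) \<open>filterlim index sequentially at_top\<close>])+
  have "\<forall>\<^sub>F r in at_top. index r \<ge> K"
    using \<open>filterlim index sequentially at_top\<close> by (simp add: filterlim_at_top)
  then have "\<forall>\<^sub>F r in at_top. l (index r) \<le> F r \<and> F r \<le> u (index r)"
    using eventually_ge_at_top [of 1]
  proof eventually_elim
    case (elim r)
    define y where "y = sqrt (ln r)"
    have "y \<ge> 0" and y2: "y ^ 2 = ln r"
      using elim by (auto simp: y_def)
    have "real (index r) \<le> y" "y \<le> real (Suc (index r))"
      unfolding index_def y_def [symmetric] using \<open>y \<ge> 0\<close> by linarith+
    then have "real (index r) ^ 2 \<le> ln r" "ln r \<le> real (Suc (index r)) ^ 2"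
      unfolding y2 [symmetric] using \<open>y \<ge> 0\<close> by (intro power_mono; simp)+
    then have "exp (real (index r) ^ 2) \<le> exp (ln r)" "exp (ln r) \<le> exp (real (Suc (index r)) ^ 2)"
      by simp_all
    then have "exp (real (index r) ^ 2) \<le> r" "r \<le> exp (real (Suc (index r)) ^ 2)"
      using elim by simp_all
    then show ?case
      using bounds elim by blast
  qed
  then show ?thesis
    by (intro tendsto_sandwich [OF _ _ lim]) (auto elim: eventually_mono)
qed

definition log_measure :: "real set \<Rightarrow> real" where
  "log_measure A = (LINT t : A | lborel. 1 / t)"

lemma set_integrable_inverse:
  assumes "A \<in> sets borel" "A \<subseteq> {1..R}"
  shows "set_integrable lborel A (\<lambda>t :: real. 1 / t)"
proof (rule set_integrable_subset)
  show "set_integrable lborel {1..R} (\<lambda>t. 1 / t)"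
    by (intro borel_integrable_atLeastAtMost' continuous_intros) auto
qed (use assms in auto)

lemma log_measure_mono:
  assumes "A \<in> sets borel" "B \<in> sets borel" "A \<subseteq> B" "B \<subseteq> {1..R}"
  shows "log_measure A \<le> log_measure B"
  unfolding log_measure_def set_lebesgue_integral_def
proof (rule integral_mono)
  show "integrable lborel (\<lambda>t :: real. indicat_real A t *\<^sub>R (1 / t))"
    using set_integrable_inverse [of A R] assms by (auto simp: set_integrable_def)
  show "integrable lborel (\<lambda>t :: real. indicat_real B t *\<^sub>R (1 / t))"
    using set_integrable_inverse [of B R] assms by (auto simp: set_integrable_def)
next
  fix t :: real
  show "indicat_real A t *\<^sub>R (1 / t) \<le> indicat_real B t *\<^sub>R (1 / t)"
    using assms by (cases "t \<in> B") (auto simp: indicator_def)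
qed

lemma log_measure_nonneg:
  assumes "A \<in> sets borel" "A \<subseteq> {1..R}"
  shows "0 \<le> log_measure A"
  using log_measure_mono [of "{}" A R] assms by (simp add: log_measure_def set_lebesgue_integral_def)

lemma log_measure_Un:
  assumes "A \<in> sets borel" "B \<in> sets borel" "A \<union> B \<subseteq> {1..R}" "A \<inter> B = {}"
  shows "log_measure (A \<union> B) = log_measure A + log_measure B"
  unfolding log_measure_def using assms
  by (intro set_integral_Un set_integrable_inverse [of _ R]) auto

lemma log_measure_Icc:
  assumes "1 \<le> a" "a \<le> b"
  shows "log_measure {a..b} = ln b - ln a"
  unfolding log_measure_def set_lebesgue_integral_def
proof (rule integral_FTC_atLeastAtMost)
  show "continuous_on {a..b} (\<lambda>t. 1 / t)"
    using assms by (intro continuous_intros) auto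
  show "(ln has_vector_derivative 1 / x) (at x within {a..b})" if "a \<le> x" "x \<le> b" for x
    using assms that
    by (auto intro!: derivative_eq_intros simp: has_real_derivative_iff_has_vector_derivative [symmetric])
qed (use assms in auto)

text \<open>
  On the logarithmic scale the period from \<open>k\<^sup>2\<close> to \<open>(k + 1)\<^sup>2\<close> has length \<open>2 k + 1\<close>. If the set misses
  the initial fraction \<open>\<delta>\<close> of each period and contains the rest up to margins \<open>e k\<close> of lower order, its
  logarithmic measure up to \<open>exp (k\<^sup>2)\<close> is \<open>(1 - \<delta>) k\<^sup>2\<close> up to an error of lower order.
\<close>

lemma log_mean_tendsto_of_gaps:
  fixes S :: "real set" and \<delta> :: real and e :: "nat \<Rightarrow> real"
  assumes "S \<in> sets borel" "0 \<le> \<delta>" "\<delta> \<le> 1"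
    and gap: "\<And>k. S \<inter> {exp (real k ^ 2)..exp (real k ^ 2 + \<delta> * (2 * real k + 1))} = {}"
    and filled: "\<And>k. k \<ge> K \<Longrightarrow>
       {exp (real k ^ 2 + \<delta> * (2 * real k + 1) + e k)..exp (real (Suc k) ^ 2 - e k)} \<subseteq> S"
    and e: "incseq e" "\<And>k. 0 < e k" "(\<lambda>k. e k / real k) \<longlonglongrightarrow> 0"
  shows "(log_mean S \<longlongrightarrow> 1 - \<delta>) at_top"
proof -
  define a where "a k = exp (real k ^ 2)" for k
  define b where "b k = exp (real k ^ 2 + \<delta> * (2 * real k + 1))" for k
  define J where "J R = log_measure (S \<inter> {1<..<R})" for R
  have a_pos: "1 \<le> a k" for k
    by (simp add: a_def)
  have ab: "a k \<le> b k" "b k \<le> a (Suc k)" for k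
  proof -
    have "\<delta> * (2 * real k + 1) \<le> 1 * (2 * real k + 1)"
      using assms by (intro mult_right_mono) auto
    then show "a k \<le> b k" "b k \<le> a (Suc k)"
      using assms by (auto simp: a_def b_def power2_eq_square algebra_simps)
  qed
  have meas: "S \<inter> A \<in> sets borel" if "A \<in> sets borel" for A
    using assms that by auto
  have J_nonneg: "0 \<le> J R" for R
    unfolding J_def by (intro log_measure_nonneg [of _ R] meas) auto
  have J_mono: "J R \<le> J R'" if "R \<le> R'" for R R'
    unfolding J_def using that by (intro log_measure_mono [of _ _ R'] meas) auto
  have ln_ba: "ln (a (Suc k)) - ln (b k) = (1 - \<delta>) * (2 * real k + 1)" for k
    by (simp add: a_def b_def power2_eq_square algebra_simps)
  have step: "J (a (Suc k)) = J (a k) + log_measure (S \<inter> ({1<..} \<inter> {a k..<a (Suc k)}))" for k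
  proof -
    have "S \<inter> {1<..<a (Suc k)} = (S \<inter> {1<..<a k}) \<union> (S \<inter> ({1<..} \<inter> {a k..<a (Suc k)}))"
      using ab [of k] by auto
    then show ?thesis
      unfolding J_def using ab [of k]
      by (subst log_measure_Un [of _ _ "a (Suc k)", symmetric]) (auto intro!: meas)
  qed
  have step_le: "J (a (Suc k)) \<le> J (a k) + (1 - \<delta>) * (2 * real k + 1)" for k
  proof -
    have "S \<inter> ({1<..} \<inter> {a k..<a (Suc k)}) \<subseteq> {b k..a (Suc k)}"
      using gap [of k] by (force simp: a_def b_def)
    then have "log_measure (S \<inter> ({1<..} \<inter> {a k..<a (Suc k)})) \<le> log_measure {b k..a (Suc k)}"
      using ab [of k] a_pos [of k] by (intro log_measure_mono [of _ _ "a (Suc k)"] meas) auto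
    also have "\<dots> = ln (a (Suc k)) - ln (b k)"
      using ab [of k] a_pos [of k] by (intro log_measure_Icc) auto
    finally show ?thesis
      unfolding step ln_ba by simp
  qed
  have step_ge: "J (a k) + (1 - \<delta>) * (2 * real k + 1) - 2 * e k \<le> J (a (Suc k))" if "k \<ge> K" for k
  proof (cases "b k * exp (e k) \<le> a (Suc k) * exp (- e k)")
    case True
    have sub: "{b k * exp (e k)..a (Suc k) * exp (- e k)} \<subseteq> S \<inter> ({1<..} \<inter> {a k..<a (Suc k)})"
    proof
      fix t assume t: "t \<in> {b k * exp (e k)..a (Suc k) * exp (- e k)}"
      have "b k < b k * exp (e k)" "a (Suc k) * exp (- e k) < a (Suc k)"
        using e(2) [of k] by (auto simp: a_def b_def)
      moreover have "b k * exp (e k) \<le> t" "t \<le> a (Suc k) * exp (- e k)"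
        using t by auto
      ultimately have "1 < t" "a k \<le> t" "t < a (Suc k)"
        using ab(1) [of k] a_pos [of k] by linarith+
      moreover have "t \<in> S"
        using filled [OF that] t
        by (auto simp: a_def b_def exp_add exp_diff exp_minus divide_inverse)
      ultimately show "t \<in> S \<inter> ({1<..} \<inter> {a k..<a (Suc k)})"
        by simp
    qed
    have bk: "1 \<le> b k * exp (e k)"
      using assms(2) e(2) [of k] by (simp add: b_def flip: exp_add)
    have "(1 - \<delta>) * (2 * real k + 1) - 2 * e k
        = ln (a (Suc k) * exp (- e k)) - ln (b k * exp (e k))"
      by (simp add: ln_ba [symmetric] ln_mult a_def b_def)
    also have "\<dots> = log_measure {b k * exp (e k)..a (Suc k) * exp (- e k)}"
      using bk True by (intro log_measure_Icc [symmetric]) auto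
    also have "\<dots> \<le> log_measure (S \<inter> ({1<..} \<inter> {a k..<a (Suc k)}))"
      using sub by (intro log_measure_mono [of _ _ "a (Suc k)"] meas) auto
    finally show ?thesis
      unfolding step by simp
  next
    \<comment> \<open>The two margins overlap, and the claimed lower bound for the increment is not positive.\<close>
    case False
    have "a (Suc k) * exp (- e k) \<le> b k * exp (e k)"
      using False by simp
    then have "ln (a (Suc k) * exp (- e k)) \<le> ln (b k * exp (e k))"
      by (intro ln_mono) (auto simp: a_def b_def)
    then have "(1 - \<delta>) * (2 * real k + 1) - 2 * e k \<le> 0"
      by (simp add: ln_ba [symmetric] ln_mult a_def b_def)
    then show ?thesis
      using J_mono [of "a k" "a (Suc k)"] ab [of k] by linarith
  qed
  have J_le: "J (a k) \<le> (1 - \<delta>) * real k ^ 2" for k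
  proof (induction k)
    case 0
    have "J (a 0) = 0"
      by (simp add: J_def a_def log_measure_def set_lebesgue_integral_def)
    then show ?case by simp
  next
    case (Suc k)
    then show ?case
      using step_le [of k] by (simp add: power2_eq_square algebra_simps)
  qed
  have J_ge: "(1 - \<delta>) * real k ^ 2 - 2 * real k * e k - real K ^ 2 \<le> J (a k)" if "k \<ge> K" for k
    using that
  proof (induction k rule: dec_induct)
    case base
    have "(1 - \<delta>) * real K ^ 2 \<le> 1 * real K ^ 2"
      using assms by (intro mult_right_mono) auto
    moreover have "0 \<le> real K * e K"
      using e(2) [of K] by simp
    ultimately show ?case
      using J_nonneg [of "a K"] by linarith
  next
    case (step k)
    have "real (Suc k) * e k \<le> real (Suc k) * e (Suc k)"
      using e(1) by (intro mult_left_mono) (auto simp: incseq_Suc_iff)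
    then have "real k * e k + e k \<le> real (Suc k) * e (Suc k)"
      by (simp add: algebra_simps)
    moreover have "(1 - \<delta>) * real (Suc k) ^ 2 = (1 - \<delta>) * real k ^ 2 + (1 - \<delta>) * (2 * real k + 1)"
      by (simp add: power2_eq_square algebra_simps)
    ultimately show ?case
      using step_ge [of k] step by linarith
  qed
  have mean: "log_mean S r = J r / ln r" for r
    by (simp add: log_mean_def J_def log_measure_def)
  show ?thesis
  proof (rule tendsto_at_top_sampled)
    fix k r
    assume k: "k \<ge> Suc K" and r: "exp (real k ^ 2) \<le> r" "r \<le> exp (real (Suc k) ^ 2)"
    have "0 < r"
      using r(1) exp_gt_zero less_le_trans by blast
    have ln_r: "real k ^ 2 \<le> ln r" "ln r \<le> real (Suc k) ^ 2"
      using r ln_mono [OF r(2) \<open>0 < r\<close>] \<open>0 < r\<close> by (simp_all add: ln_ge_iff del: of_nat_Suc)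
    have k2: "0 < real k ^ 2"
      using k by simp
    have J1: "J (a k) \<le> J r" "J r \<le> J (a (Suc k))"
      using r by (intro J_mono; simp add: a_def)+
    define N where "N = (1 - \<delta>) * real k ^ 2 - 2 * real k * e k - real K ^ 2"
    have "max 0 N \<le> J r"
      using J_ge [of k] k J1 J_nonneg [of r] by (auto simp: N_def)
    then have "max 0 N / real (Suc k) ^ 2 \<le> J r / ln r"
      using ln_r k2 J_nonneg [of r] by (intro frac_le) linarith+
    moreover have "N / real (Suc k) ^ 2 \<le> max 0 N / real (Suc k) ^ 2"
      by (intro divide_right_mono) auto
    moreover have "J r / ln r \<le> (1 - \<delta>) * real (Suc k) ^ 2 / real k ^ 2"
      using ln_r k2 J_nonneg [of r] J1 J_le [of "Suc k"] by (intro frac_le) linarith+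
    ultimately show "N / real (Suc k) ^ 2 \<le> log_mean S r
        \<and> log_mean S r \<le> (1 - \<delta>) * real (Suc k) ^ 2 / real k ^ 2"
      unfolding mean by linarith
  next
    have "(\<lambda>k. (1 - \<delta>) * (real (Suc k) ^ 2 / real k ^ 2)) \<longlonglongrightarrow> (1 - \<delta>) * 1"
      by (intro tendsto_intros) real_asymp
    then show "(\<lambda>k. (1 - \<delta>) * real (Suc k) ^ 2 / real k ^ 2) \<longlonglongrightarrow> 1 - \<delta>"
      by simp
  next
    have "(\<lambda>k. (1 - \<delta>) * (real k ^ 2 / real (Suc k) ^ 2)
        - 2 * ((e k / real k) * (real k ^ 2 / real (Suc k) ^ 2))
        - real K ^ 2 * (1 / real (Suc k) ^ 2)) \<longlonglongrightarrow> (1 - \<delta>) * 1 - 2 * (0 * 1) - real K ^ 2 * 0"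
      by (intro tendsto_intros e(3)) real_asymp+
    then have "(\<lambda>k. (1 - \<delta>) * (real k ^ 2 / real (Suc k) ^ 2)
        - 2 * ((e k / real k) * (real k ^ 2 / real (Suc k) ^ 2))
        - real K ^ 2 * (1 / real (Suc k) ^ 2)) \<longlonglongrightarrow> 1 - \<delta>"
      by simp
    then show "(\<lambda>k. ((1 - \<delta>) * real k ^ 2 - 2 * real k * e k - real K ^ 2) / real (Suc k) ^ 2)
        \<longlonglongrightarrow> 1 - \<delta>"
      by (rule Lim_transform_eventually)
        (use eventually_gt_at_top [of 0] in eventually_elim,
          simp add: diff_divide_distrib power2_eq_square)
  qed
qed

section \<open>Zeros on slits\<close>

lemma exists_power_of_two_between:
  fixes t :: real
  assumes "1 \<le> t"
  shows "\<exists>m. t \<le> 2 ^ m \<and> 2 ^ m \<le> 2 * t"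
proof -
  define m where "m = (LEAST m. t \<le> 2 ^ m)"
  have ex: "\<exists>m. t \<le> 2 ^ m"
    using real_arch_pow [of 2 t] by (auto intro: less_imp_le)
  then have m: "t \<le> 2 ^ m"
    unfolding m_def by (metis (mono_tags, lifting) LeastI)
  have "2 ^ m \<le> 2 * t"
  proof (cases m)
    case (Suc j)
    then have "\<not> t \<le> 2 ^ j"
      using not_less_Least [of j "\<lambda>m. t \<le> 2 ^ m"] by (simp add: m_def)
    then show ?thesis
      using Suc by simp
  qed (use assms in simp)
  with m show ?thesis
    by blast
qed

text \<open>
  The slits lie between \<open>left_end k = exp (k\<^sup>2)\<close> and \<open>right_end k\<close>, and fill the fraction \<open>2 * \<rho>\<close> of the
  period from \<open>k\<^sup>2\<close> to \<open>(k + 1)\<^sup>2\<close> on the logarithmic scale. Crossing a slit multiplies the degree by about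
  \<open>sqrt (right_end k / left_end k)\<close>, that is by \<open>exp (\<rho> * (2 * k + 1))\<close>, which is the growth of order \<open>\<rho>\<close>.
  The fourth power of a factorial in the degree adds a factor \<open>(k + 2) ^ 4\<close> at each step. It is large
  enough to beat all polynomial losses in the estimates, and its logarithm is of lower order than \<open>k\<^sup>2\<close>.
\<close>

locale slit_parameters =
  fixes \<rho> :: real
  assumes rho_nonneg: "0 \<le> \<rho>" and rho_less: "\<rho> < 1 / 2"
begin

definition left_end :: "nat \<Rightarrow> real" where
  "left_end k = exp (real k ^ 2)"

definition right_end :: "nat \<Rightarrow> real" where
  "right_end k = exp (real k ^ 2 + 2 * \<rho> * (2 * real k + 1))"

definition target_degree :: "nat \<Rightarrow> real" where
  "target_degree k = exp (\<rho> * real (Suc k) ^ 2) * fact (k + 2) ^ 4"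

text \<open>
  This is the bound \<open>2 * target_degree k / sqrt (left_end k * right_end k)\<close> for the sum of the inverse
  zeros, multiplied out.
\<close>

definition inverse_bound :: "nat \<Rightarrow> real" where
  "inverse_bound k = 2 * exp (- ((1 - \<rho>) * real k ^ 2)) * fact (k + 2) ^ 4"

lemma left_end_ge_1: "1 \<le> left_end k"
  by (simp add: left_end_def)

lemma left_end_mono: "j \<le> k \<Longrightarrow> left_end j \<le> left_end k"
  by (auto simp: left_end_def intro!: power_mono)

lemma left_end_le_right_end: "left_end k \<le> right_end k"
  using rho_nonneg by (simp add: left_end_def right_end_def)

lemma right_end_le_left_end:
  assumes "j < k" shows "right_end j \<le> left_end k"
proof -
  have "2 * \<rho> * (2 * real j + 1) \<le> 1 * (2 * real j + 1)"
    using rho_less by (intro mult_right_mono) auto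
  then have "right_end j \<le> left_end (Suc j)"
    by (simp add: left_end_def right_end_def power2_eq_square algebra_simps)
  also have "\<dots> \<le> left_end k"
    using assms by (intro left_end_mono) auto
  finally show ?thesis .
qed

lemma target_degree_ge_1: "1 \<le> target_degree k"
proof -
  have "1 * 1 \<le> exp (\<rho> * real (Suc k) ^ 2) * (fact (k + 2) :: real) ^ 4"
    using rho_nonneg by (intro mult_mono) (auto intro!: one_le_power simp: fact_ge_1 simp del: fact_Suc)
  then show ?thesis
    by (simp add: target_degree_def)
qed

lemma target_degree_mono: "j \<le> k \<Longrightarrow> target_degree j \<le> target_degree k"
  unfolding target_degree_def using rho_nonneg
  by (intro mult_mono power_mono fact_mono) (auto intro!: mult_left_mono power_mono)

lemma inverse_bound_pos: "0 < inverse_bound k"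
  by (simp add: inverse_bound_def)

text \<open>
  At the radius \<open>left_end (Suc k)\<close> the influence of the next group of zeros exceeds that of the degree
  accumulated so far only by a polynomial factor. Therefore the margin that has to be removed at
  the right end of each gap is logarithmic in \<open>k\<close>.
\<close>

lemma left_end_times_inverse_bound:
  "left_end (Suc k) * inverse_bound (Suc k) = 2 * (real k + 3) ^ 4 * target_degree k"
proof -
  have "(fact (Suc k + 2) :: real) = (real k + 3) * fact (k + 2)"
    by (simp add: algebra_simps)
  moreover have "exp (real (Suc k) ^ 2) * exp (- ((1 - \<rho>) * real (Suc k) ^ 2))
      = exp (\<rho> * real (Suc k) ^ 2)"
    by (simp add: algebra_simps flip: exp_add)
  ultimately show ?thesis
    by (simp add: left_end_def inverse_bound_def target_degree_def power_mult_distrib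
        mult_ac del: fact_Suc)
qed

lemma inverse_bound_Suc_le:
  "inverse_bound (Suc k) \<le> inverse_bound k * (exp (- real k) * (real k + 3) ^ 4)"
proof -
  have f: "(fact (Suc k + 2) :: real) = (real k + 3) * fact (k + 2)"
    by (simp add: algebra_simps)
  have "real k \<le> (1 - \<rho>) * (2 * real k + 1)"
  proof -
    have "real k \<le> 1 / 2 * (2 * real k + 1)"
      by simp
    also have "\<dots> \<le> (1 - \<rho>) * (2 * real k + 1)"
      using rho_less by (intro mult_right_mono) auto
    finally show ?thesis .
  qed
  moreover have "(1 - \<rho>) * real (Suc k) ^ 2 = (1 - \<rho>) * real k ^ 2 + (1 - \<rho>) * (2 * real k + 1)"
    by (simp add: power2_eq_square algebra_simps)
  ultimately have "exp (- ((1 - \<rho>) * real (Suc k) ^ 2)) \<le> exp (- ((1 - \<rho>) * real k ^ 2)) * exp (- real k)"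
    by (simp flip: exp_add)
  then have "exp (- ((1 - \<rho>) * real (Suc k) ^ 2)) * (2 * fact (Suc k + 2) ^ 4)
      \<le> exp (- ((1 - \<rho>) * real k ^ 2)) * exp (- real k) * (2 * fact (Suc k + 2) ^ 4)"
    by (rule mult_right_mono) simp
  then show ?thesis
    unfolding inverse_bound_def f by (simp add: power_mult_distrib mult_ac del: fact_Suc)
qed

text \<open>
  The bounds for the inverse sums decrease faster than geometrically, so every late tail is
  dominated by its first term.
\<close>

lemma eventually_inverse_bound_halves:
  "\<exists>K. \<forall>n\<ge>K. \<forall>j. inverse_bound (j + n) \<le> inverse_bound n * (1 / 2) ^ j"
proof -
  have "(\<lambda>k. exp (- real k) * (real k + 3) ^ 4) \<longlonglongrightarrow> 0"
    by real_asymp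
  then have "\<forall>\<^sub>F k in sequentially. exp (- real k) * (real k + 3) ^ 4 < 1 / 2"
    by (rule order_tendstoD) simp
  then obtain K where K: "\<And>k. k \<ge> K \<Longrightarrow> exp (- real k) * (real k + 3) ^ 4 < 1 / 2"
    by (auto simp: eventually_sequentially)
  have "inverse_bound (j + n) \<le> inverse_bound n * (1 / 2) ^ j" if "n \<ge> K" for n j
  proof (induction j)
    case (Suc j)
    have "inverse_bound (Suc (j + n)) \<le> inverse_bound (j + n) * (1 / 2)"
      using K [of "j + n"] that inverse_bound_pos [of "j + n"]
      by (intro order.trans [OF inverse_bound_Suc_le] mult_left_mono) auto
    also have "\<dots> \<le> inverse_bound n * (1 / 2) ^ j * (1 / 2)"
      using Suc by (intro mult_right_mono) auto
    finally show ?case by simp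
  qed simp
  then show ?thesis by blast
qed

lemma summable_inverse_bound: "summable inverse_bound"
proof -
  obtain K where K: "\<And>j. inverse_bound (j + K) \<le> inverse_bound K * (1 / 2) ^ j"
    using eventually_inverse_bound_halves by blast
  have "summable (\<lambda>j. inverse_bound (j + K))"
    by (rule summable_comparison_test [OF _ summable_mult [OF summable_geometric [of "1 / 2 :: real"]]])
      (use K inverse_bound_pos in \<open>auto simp: abs_of_pos\<close>)
  then show ?thesis
    by simp
qed

end

text \<open>
  Here \<open>exp (- (\<rho> * (2 * k + 1)))\<close> is \<open>sqrt (left_end k / right_end k)\<close>, and
  \<open>exp (k\<^sup>2 + \<rho> * (2 * k + 1))\<close> is \<open>sqrt (left_end k * right_end k)\<close>. The degrees are determined only up to
  a factor \<open>2\<close> because they have to be powers of two.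
\<close>

locale slit_zeros = slit_parameters +
  fixes X :: "nat \<Rightarrow> real list"
  assumes zeros_in_slit: "set (X k) \<subseteq> {left_end k..right_end k}"
    and degree_ge: "target_degree k \<le> length (X k)"
    and degree_le: "length (X k) \<le> 2 * target_degree k"
    and small_on_slit: "r \<in> {left_end k..right_end k} \<Longrightarrow>
          \<bar>\<Prod>x\<leftarrow>X k. 1 - r / x\<bar> \<le> 2 * exp (- (length (X k) * exp (- (\<rho> * (2 * real k + 1)))))"
    and inverses_le: "(\<Sum>x\<leftarrow>X k. 1 / x) \<le> length (X k) * exp (- (real k ^ 2 + \<rho> * (2 * real k + 1)))"
begin

lemma zeros_bounds:
  assumes "x \<in> set (X k)"
  shows "left_end k \<le> x" "x \<le> right_end k" "1 \<le> x"
proof -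
  show "left_end k \<le> x" "x \<le> right_end k"
    using assms zeros_in_slit by force+
  then show "1 \<le> x"
    using left_end_ge_1 [of k] by linarith
qed

lemma inverses_le_inverse_bound: "(\<Sum>x\<leftarrow>X k. 1 / x) \<le> inverse_bound k"
proof -
  have "(\<Sum>x\<leftarrow>X k. 1 / x) \<le> 2 * target_degree k * exp (- (real k ^ 2 + \<rho> * (2 * real k + 1)))"
    using degree_le by (intro order.trans [OF inverses_le] mult_right_mono) auto
  also have "\<dots> = 2 * fact (k + 2) ^ 4 *
      (exp (\<rho> * real (Suc k) ^ 2) * exp (- (real k ^ 2 + \<rho> * (2 * real k + 1))))"
    by (simp add: target_degree_def)
  also have "exp (\<rho> * real (Suc k) ^ 2) * exp (- (real k ^ 2 + \<rho> * (2 * real k + 1)))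
      = exp (- ((1 - \<rho>) * real k ^ 2))"
    by (simp add: power2_eq_square algebra_simps flip: exp_add)
  finally show ?thesis
    by (simp add: inverse_bound_def mult_ac)
qed

sublocale negative_zeros X
proof
  show "0 < x" if "x \<in> set (X k)" for k x
    using zeros_bounds [OF that] by simp
  then have "0 \<le> (\<Sum>x\<leftarrow>X k. 1 / x)" for k
    by (intro sum_list_nonneg) (auto intro: less_imp_le)
  then show "summable (\<lambda>k. \<Sum>x\<leftarrow>X k. 1 / x)"
    using inverses_le_inverse_bound
    by (intro summable_comparison_test [OF _ summable_inverse_bound]) auto
qed

lemma inverse_tail_le:
  assumes "\<And>j. inverse_bound (j + n) \<le> inverse_bound n * (1 / 2) ^ j"
  shows "inverse_tail n \<le> 2 * inverse_bound n"
proof -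
  have "inverse_sum (j + n) \<le> inverse_bound n * (1 / 2) ^ j" for j
    using assms inverses_le_inverse_bound unfolding inverse_sum_def by (rule order.trans [rotated])
  then have "inverse_tail n \<le> (\<Sum>j. inverse_bound n * (1 / 2) ^ j)"
    unfolding inverse_tail_def
    by (intro suminf_le summable_ignore_initial_segment summable_inverse_sum
        summable_mult summable_geometric) auto
  also have "\<dots> = 2 * inverse_bound n"
    by (subst suminf_mult) (auto simp: suminf_geometric summable_geometric)
  finally show ?thesis .
qed

lemma total_degree_le:
  "(\<Sum>j<Suc k. real (length (X j))) \<le> 2 * real (Suc k) * target_degree k"
proof -
  have "(\<Sum>j<Suc k. real (length (X j))) \<le> (\<Sum>j<Suc k. 2 * target_degree k)"
  proof (rule sum_mono)
    fix j assume "j \<in> {..<Suc k}"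
    then have "target_degree j \<le> target_degree k"
      by (intro target_degree_mono) auto
    then show "real (length (X j)) \<le> 2 * target_degree k"
      using degree_le [of j] by linarith
  qed
  also have "\<dots> = 2 * real (Suc k) * target_degree k"
    by simp
  finally show ?thesis .
qed

lemma norm_factor_product_le:
  assumes "\<And>j x. \<lbrakk>j < k; x \<in> set (X j)\<rbrakk> \<Longrightarrow> norm (1 + z / of_real x) \<le> c"
  shows "norm (\<Prod>j<k. factor j z) \<le> c ^ (\<Sum>j<k. length (X j))"
proof -
  have "norm (factor j z) \<le> c ^ length (X j)" if "j < k" for j
    unfolding factor_def norm_prod_list using assms that by (auto intro!: prod_list_le_power)
  then show ?thesis
    by (auto simp: power_sum prod_norm [symmetric] intro!: prod_mono)
qed

lemma norm_factor_product_ge: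
  assumes "\<And>j x. \<lbrakk>j < k; x \<in> set (X j)\<rbrakk> \<Longrightarrow> c \<le> norm (1 + z / of_real x)" "0 \<le> c"
  shows "c ^ (\<Sum>j<k. length (X j)) \<le> norm (\<Prod>j<k. factor j z)"
proof -
  have "c ^ length (X j) \<le> norm (factor j z)" if "j < k" for j
    unfolding factor_def norm_prod_list using assms that by (auto intro!: power_le_prod_list)
  then show ?thesis
    using assms(2) by (auto simp: power_sum prod_norm [symmetric] intro!: prod_mono)
qed

lemma norm_linear_factor:
  "norm (1 + of_real r / complex_of_real x) = \<bar>1 + r / x\<bar>"
  "norm (1 + - of_real r / complex_of_real x) = \<bar>1 - r / x\<bar>"
proof -
  have "1 + of_real r / complex_of_real x = of_real (1 + r / x)"
    "1 + - of_real r / complex_of_real x = of_real (1 - r / x)"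
    by simp_all
  then show "norm (1 + of_real r / complex_of_real x) = \<bar>1 + r / x\<bar>"
    "norm (1 + - of_real r / complex_of_real x) = \<bar>1 - r / x\<bar>"
    by (metis norm_of_real)+
qed

text \<open>
  The right side is the exponent of the decay of the \<open>k\<close>-th factor on its own slit. The left side bounds
  the logarithm of everything it has to compensate there: the constant \<open>2\<close>, and the earlier zeros, each
  of which contributes a factor of at most \<open>exp ((k + 1)\<^sup>2)\<close>.
\<close>

lemma degree_dominates:
  "ln 2 + (\<Sum>j<k. real (length (X j))) * real (Suc k) ^ 2
     \<le> length (X k) * exp (- (\<rho> * (2 * real k + 1)))"
proof -
  have ln2: "ln 2 \<le> (1 :: real)"
    using ln_le_minus_one [of "2 :: real"] by simp
  \<comment> \<open>\<open>g\<close> is \<open>target_degree (k - 1)\<close> for positive \<open>k\<close>, in a form that also makes sense for \<open>k = 0\<close>.\<close>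
  define g where "g = exp (\<rho> * real k ^ 2) * fact (k + 1) ^ 4"
  have "1 * 1 \<le> exp (\<rho> * real k ^ 2) * (fact (k + 1) :: real) ^ 4"
    using rho_nonneg by (intro mult_mono) (auto intro!: one_le_power simp: fact_ge_1 simp del: fact_Suc)
  then have g: "1 \<le> g"
    by (simp add: g_def)
  have D: "(\<Sum>j<k. real (length (X j))) \<le> 2 * real k * g"
  proof (cases k)
    case (Suc i)
    then show ?thesis
      using total_degree_le [of i] by (simp add: g_def target_degree_def)
  qed simp
  have "ln 2 + (\<Sum>j<k. real (length (X j))) * real (Suc k) ^ 2
      \<le> g + 2 * real k * g * real (Suc k) ^ 2"
    using D g ln2 by (intro add_mono mult_right_mono) auto
  also have "\<dots> = g * (1 + 2 * real k * (real k + 1) ^ 2)"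
    by (simp add: algebra_simps)
  also have "\<dots> \<le> g * (real k + 2) ^ 4"
    using g by (intro mult_left_mono) (auto simp: power2_eq_square power4_eq_xxxx algebra_simps)
  also have "\<dots> = target_degree k * exp (- (\<rho> * (2 * real k + 1)))"
  proof -
    have "exp (\<rho> * real (Suc k) ^ 2) * exp (- (\<rho> * (2 * real k + 1))) = exp (\<rho> * real k ^ 2)"
      by (simp add: power2_eq_square algebra_simps flip: exp_add)
    moreover have "(fact (k + 2) :: real) = (real k + 2) * fact (k + 1)"
      by (simp add: algebra_simps)
    ultimately show ?thesis
      by (simp add: g_def target_degree_def power_mult_distrib mult_ac del: fact_Suc)
  qed
  also have "\<dots> \<le> length (X k) * exp (- (\<rho> * (2 * real k + 1)))"
    using degree_ge by (intro mult_right_mono) auto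
  finally show ?thesis .
qed

text \<open>
  The earlier factors are compensated by the \<open>k\<close>-th factor, and all later linear factors lie between
  \<open>0\<close> and \<open>1\<close>.
\<close>

lemma canonical_product_le_1_on_slit:
  assumes "r \<in> {left_end k..right_end k}"
  shows "norm (canonical_product (- of_real r)) \<le> 1"
proof -
  have r: "left_end k \<le> r" "r \<le> right_end k" "1 \<le> r"
    using assms left_end_ge_1 [of k] by auto
  have r_exp: "r \<le> exp (real (Suc k) ^ 2)"
    using r right_end_le_left_end [of k "Suc k"] by (simp add: left_end_def)
  define D where "D = (\<Sum>j<k. length (X j))"
  have "norm (\<Prod>j<k. factor j (- of_real r)) \<le> exp (real (Suc k) ^ 2) ^ D"
    unfolding D_def
  proof (rule norm_factor_product_le)
    fix j x assume "x \<in> set (X j)"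
    then have x: "1 \<le> x" by (rule zeros_bounds)
    have "\<bar>1 - r / x\<bar> \<le> r"
    proof -
      have "0 \<le> r / x" "r / x \<le> r"
        using x r(3) frac_le [of r r 1 x] by auto
      then show ?thesis
        using r(3) by linarith
    qed
    then show "norm (1 + - of_real r / complex_of_real x) \<le> exp (real (Suc k) ^ 2)"
      unfolding norm_linear_factor using r_exp by linarith
  qed
  also have "\<dots> = exp (real D * real (Suc k) ^ 2)"
    by (simp add: exp_of_nat_mult)
  finally have "norm (\<Prod>j<k. factor j (- of_real r)) \<le> exp (real D * real (Suc k) ^ 2)" .
  moreover have "norm (factor k (- of_real r))
      \<le> 2 * exp (- (length (X k) * exp (- (\<rho> * (2 * real k + 1)))))"
    using small_on_slit [OF assms] by (simp add: norm_factor_minus_of_real abs_prod_list)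
  ultimately have "norm (\<Prod>j<Suc k. factor j (- of_real r))
      \<le> exp (real D * real (Suc k) ^ 2) * (2 * exp (- (length (X k) * exp (- (\<rho> * (2 * real k + 1))))))"
    unfolding prod.lessThan_Suc norm_mult by (intro mult_mono) auto
  also have "\<dots> = exp (ln 2 + real D * real (Suc k) ^ 2
      - length (X k) * exp (- (\<rho> * (2 * real k + 1))))"
    by (simp add: exp_add exp_diff exp_minus divide_inverse)
  also have "\<dots> \<le> 1"
    using degree_dominates [of k] by (simp add: D_def)
  finally have "norm (\<Prod>j<Suc k. factor j (- of_real r)) \<le> 1" .
  moreover have "norm (factor j (- of_real r)) \<le> exp (0 * inverse_sum j)" if "j \<ge> Suc k" for j
  proof -
    have "\<bar>1 - r / x\<bar> \<le> 1" if "x \<in> set (X j)" for x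
    proof -
      have "right_end k \<le> left_end j"
        using \<open>j \<ge> Suc k\<close> by (intro right_end_le_left_end) auto
      then have "r \<le> x" "0 < x"
        using zeros_bounds [OF that] r by auto
      then show ?thesis
        using r(3) by (auto simp: abs_le_iff)
    qed
    then show ?thesis
      using prod_list_le_power [of "X j" "\<lambda>x. \<bar>1 - r / x\<bar>" 1]
      by (simp add: norm_factor_minus_of_real)
  qed
  ultimately show ?thesis
    using norm_canonical_product_upper
      [where n = "Suc k" and z = "- of_real r" and c = 1 and d = 0] by simp
qed

text \<open>
  To the right of \<open>3 * right_end k\<close> every linear factor belonging to the zeros passed so far has modulus
  at least \<open>2\<close>. The zeros still ahead reduce the product by less than that as long as \<open>r\<close> stays away
  from the next slit by a polynomial factor.
\<close>

lemma canonical_product_gt_1_between_slits: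
  assumes halves: "\<And>j. inverse_bound (j + Suc k) \<le> inverse_bound (Suc k) * (1 / 2) ^ j"
    and r: "3 * right_end k \<le> r" "r * (16 * (real k + 3) ^ 4) \<le> left_end (Suc k)"
  shows "1 < norm (canonical_product (- of_real r))"
proof -
  define D where "D = (\<Sum>j<Suc k. length (X j))"
  have r0: "0 < r"
    using r(1) by (simp add: right_end_def) (smt (verit) exp_gt_zero)
  have two: "2 ^ D \<le> norm (\<Prod>j<Suc k. factor j (- of_real r))"
    unfolding D_def
  proof (rule norm_factor_product_ge)
    fix j x assume jx: "j < Suc k" "x \<in> set (X j)"
    have "x \<le> right_end k"
    proof (cases "j = k")
      case False
      then have "right_end j \<le> left_end k"
        using jx by (intro right_end_le_left_end) auto
      then show ?thesis
        using zeros_bounds [OF jx(2)] left_end_le_right_end [of k] by linarith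
    qed (use zeros_bounds [OF jx(2)] in auto)
    then have "3 \<le> r / x"
      using r(1) zeros_bounds [OF jx(2)] by (simp add: le_divide_eq)
    then show "2 \<le> norm (1 + - of_real r / complex_of_real x)"
      unfolding norm_linear_factor by linarith
  qed simp
  have "1 \<le> (real k + 3) ^ 4"
    by (intro one_le_power) simp
  then have "r * 16 \<le> r * (16 * (real k + 3) ^ 4)"
    using r0 by (intro mult_left_mono) auto
  then have r16: "r * 16 \<le> left_end (Suc k)"
    using r(2) by linarith
  have later: "exp (- (2 * r * inverse_sum j)) \<le> norm (factor j (- of_real r))" if "j \<ge> Suc k" for j
  proof (rule exp_le_norm_factor_minus)
    fix x assume "x \<in> set (X j)"
    then have "left_end (Suc k) \<le> x"
      using zeros_bounds(1) left_end_mono [OF that] by force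
    then show "2 * r \<le> x"
      using r16 r0 by linarith
  qed (use r0 in simp)
  have "length (X k) \<le> D"
    by (simp add: D_def)
  then have D: "target_degree k \<le> real D"
    using degree_ge [of k] by linarith
  have "2 * r * (2 * inverse_bound (Suc k)) * (4 * (real k + 3) ^ 4)
      = r * (16 * (real k + 3) ^ 4) * inverse_bound (Suc k)"
    by simp
  also have "\<dots> \<le> left_end (Suc k) * inverse_bound (Suc k)"
    using r(2) inverse_bound_pos [of "Suc k"] by (intro mult_right_mono) auto
  also have "\<dots> = target_degree k / 2 * (4 * (real k + 3) ^ 4)"
    unfolding left_end_times_inverse_bound by simp
  finally have "2 * r * (2 * inverse_bound (Suc k)) \<le> target_degree k / 2"
    by (rule mult_right_le_imp_le) simp
  moreover have "2 * r * inverse_tail (Suc k) \<le> 2 * r * (2 * inverse_bound (Suc k))"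
    using r0 inverse_tail_le [of "Suc k"] halves by (intro mult_left_mono) auto
  ultimately have "2 * r * inverse_tail (Suc k) \<le> target_degree k / 2"
    by linarith
  also have "\<dots> \<le> real D / 2"
    using D by simp
  also have "\<dots> < real D * ln 2"
  proof -
    have "1 \<le> real D"
      using D target_degree_ge_1 [of k] by linarith
    then show ?thesis
      using ln2_ge_two_thirds by simp
  qed
  finally have "1 < exp (real D * ln 2 - 2 * r * inverse_tail (Suc k))"
    by simp
  also have "\<dots> = 2 ^ D * exp (- (2 * r * inverse_tail (Suc k)))"
    by (simp add: exp_diff exp_minus divide_inverse exp_of_nat_mult)
  also have "\<dots> \<le> norm (canonical_product (- of_real r))"
    using two later r0 by (intro norm_canonical_product_lower) auto
  finally show ?thesis .
qed

text \<open>
  The zeros up to \<open>left_end (Suc k)\<close> and the zeros beyond it each contribute at most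
  \<open>4 * (k + 3) ^ 4 * target_degree k\<close> to the exponent.
\<close>

lemma canonical_product_growth_upper:
  assumes halves: "\<And>j. inverse_bound (j + Suc k) \<le> inverse_bound (Suc k) * (1 / 2) ^ j"
    and r: "0 \<le> r" "r \<le> left_end (Suc k)"
  shows "norm (canonical_product (of_real r)) \<le> exp (8 * (real k + 3) ^ 4 * target_degree k)"
proof -
  define D where "D = (\<Sum>j<Suc k. length (X j))"
  have "norm (\<Prod>j<Suc k. factor j (of_real r)) \<le> exp (real (Suc k) ^ 2 + 1) ^ D"
    unfolding D_def
  proof (rule norm_factor_product_le)
    fix j x assume "x \<in> set (X j)"
    then have x: "1 \<le> x" by (rule zeros_bounds)
    have "\<bar>1 + r / x\<bar> \<le> 1 + r"
      using x r frac_le [of r r 1 x] by auto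
    also have "\<dots> \<le> 2 * left_end (Suc k)"
      using r left_end_ge_1 [of "Suc k"] by linarith
    also have "\<dots> \<le> exp 1 * left_end (Suc k)"
      using exp_ge_add_one_self [of 1] by (intro mult_right_mono) (auto simp: left_end_def)
    also have "\<dots> = exp (real (Suc k) ^ 2 + 1)"
      by (simp add: left_end_def exp_add)
    finally show "norm (1 + of_real r / complex_of_real x) \<le> exp (real (Suc k) ^ 2 + 1)"
      unfolding norm_linear_factor .
  qed
  moreover have "norm (factor j (of_real r)) \<le> exp (r * inverse_sum j)" for j
    using norm_factor_le_exp [of j "of_real r"] r by simp
  ultimately have "norm (canonical_product (of_real r))
      \<le> exp (real (Suc k) ^ 2 + 1) ^ D * exp (r * inverse_tail (Suc k))"
    using r by (intro norm_canonical_product_upper) auto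
  also have "\<dots> = exp (real D * (real (Suc k) ^ 2 + 1) + r * inverse_tail (Suc k))"
    by (simp add: exp_of_nat_mult exp_add)
  also have "\<dots> \<le> exp (8 * (real k + 3) ^ 4 * target_degree k)"
  proof -
    have "real D * (real (Suc k) ^ 2 + 1) \<le> 2 * real (Suc k) * target_degree k * (real (Suc k) ^ 2 + 1)"
      using total_degree_le [of k] by (intro mult_right_mono) (auto simp: D_def)
    also have "\<dots> = target_degree k * (2 * (real k + 1) * ((real k + 1) ^ 2 + 1))"
      by (simp add: algebra_simps)
    also have "\<dots> \<le> target_degree k * (4 * (real k + 3) ^ 4)"
      using target_degree_ge_1 [of k]
      by (intro mult_left_mono) (auto simp: power2_eq_square power4_eq_xxxx algebra_simps)
    finally have 1: "real D * (real (Suc k) ^ 2 + 1) \<le> target_degree k * (4 * (real k + 3) ^ 4)" .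
    have "0 \<le> inverse_tail (Suc k)"
      using sum_inverse_le_tail [of "Suc k" "Suc k"] by simp
    then have "r * inverse_tail (Suc k) \<le> left_end (Suc k) * (2 * inverse_bound (Suc k))"
      using r inverse_tail_le [of "Suc k"] halves by (intro mult_mono) (auto simp: left_end_def)
    also have "\<dots> = target_degree k * (4 * (real k + 3) ^ 4)"
      using left_end_times_inverse_bound [of k] by (simp add: mult_ac)
    finally have "real D * (real (Suc k) ^ 2 + 1) + r * inverse_tail (Suc k)
        \<le> target_degree k * (4 * (real k + 3) ^ 4) + target_degree k * (4 * (real k + 3) ^ 4)"
      using 1 by (intro add_mono)
    then show ?thesis
      by (simp add: mult_ac)
  qed
  finally show ?thesis .
qed

lemma canonical_product_growth_lower:
  assumes "right_end k \<le> r"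
  shows "exp (exp (\<rho> * real (Suc k) ^ 2)) \<le> norm (canonical_product (of_real r))"
proof -
  have r0: "0 \<le> r"
    using assms left_end_ge_1 [of k] left_end_le_right_end [of k] by linarith
  have one: "1 \<le> norm (factor j (of_real r))" for j
  proof -
    have "1 \<le> \<bar>1 + r / x\<bar>" if "x \<in> set (X j)" for x
    proof -
      have "0 \<le> r / x"
        using r0 zeros_pos [OF that] by simp
      then show ?thesis by linarith
    qed
    then show ?thesis
      using power_le_prod_list [of "X j" 1 "\<lambda>x. \<bar>1 + r / x\<bar>"]
      by (simp add: norm_factor_of_real)
  qed
  have two: "2 ^ length (X k) \<le> norm (factor k (of_real r))"
    unfolding norm_factor_of_real
  proof (rule power_le_prod_list)
    fix x assume "x \<in> set (X k)"
    then have "1 \<le> r / x"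
      using zeros_bounds [of x k] assms by simp
    then show "2 \<le> \<bar>1 + r / x\<bar>" by simp
  qed simp
  have "exp (exp (\<rho> * real (Suc k) ^ 2)) \<le> exp (target_degree k / 2)"
  proof -
    have "(2 :: real) ^ 4 \<le> fact (k + 2) ^ 4"
      using fact_mono [of 2 "k + 2", where 'a = real] by (intro power_mono) (simp_all add: fact_2 del: fact_Suc)
    then have "exp (\<rho> * real (Suc k) ^ 2) * 2 \<le> exp (\<rho> * real (Suc k) ^ 2) * fact (k + 2) ^ 4"
      by (intro mult_left_mono) auto
    then show ?thesis
      by (simp add: target_degree_def del: fact_Suc)
  qed
  also have "\<dots> \<le> exp (length (X k) * ln 2)"
  proof -
    have "target_degree k * (1 / 2) \<le> length (X k) * ln 2"
      using degree_ge [of k] target_degree_ge_1 [of k] ln2_ge_two_thirds by (intro mult_mono) auto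
    then show ?thesis by simp
  qed
  also have "\<dots> = 2 ^ length (X k)"
    by (simp add: exp_of_nat_mult)
  also have "\<dots> \<le> norm (\<Prod>j<Suc k. factor j (of_real r))"
  proof -
    have "1 \<le> (\<Prod>j<k. norm (factor j (of_real r)))"
      using one by (intro prod_ge_1) auto
    then have "1 * 2 ^ length (X k) \<le> (\<Prod>j<k. norm (factor j (of_real r))) * norm (factor k (of_real r))"
      using two by (intro mult_mono) auto
    then show ?thesis
      by (simp add: prod_norm norm_mult)
  qed
  finally show ?thesis
    using one norm_canonical_product_lower [where n = "Suc k" and z = "of_real r" and d = 0
        and c = "exp (exp (\<rho> * real (Suc k) ^ 2))"]
    by simp
qed

lemma transcendental: "transcendental_entire canonical_product"
proof (rule transcendental_canonical_product)
  fix B :: real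
  obtain k where k: "B < real k"
    using reals_Archimedean2 by blast
  have "real k \<le> real k ^ 2"
    by (cases k) (auto simp: power2_eq_square)
  also have "\<dots> \<le> left_end k"
    unfolding left_end_def using exp_ge_add_one_self [of "real k ^ 2"] by linarith
  finally have "B < left_end k"
    using k by simp
  moreover have "X k \<noteq> []"
    using degree_ge [of k] target_degree_ge_1 [of k] by auto
  then have "hd (X k) \<in> set (X k)"
    by simp
  ultimately show "\<exists>k. \<exists>x\<in>set (X k). B < x"
    using zeros_bounds(1) by (meson less_le_trans)
qed

lemma growth_order_eq: "growth_order canonical_product = ereal \<rho>"
proof -
  obtain K where K: "\<And>n j. n \<ge> K \<Longrightarrow> inverse_bound (j + n) \<le> inverse_bound n * (1 / 2) ^ j"
    using eventually_inverse_bound_halves by blast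
  define u where "u k = (\<rho> * real (Suc k) ^ 2 + 4 * ((real k + 2) * ln (real k + 2))
      + ln 8 + 4 * ln (real k + 3)) / real k ^ 2" for k
  have "((\<lambda>r. ln (ln (max_modulus r canonical_product)) / ln r) \<longlongrightarrow> \<rho>) at_top"
  proof (rule tendsto_at_top_sampled)
    fix k r
    assume k: "k \<ge> Suc K" and r: "exp (real k ^ 2) \<le> r" "r \<le> exp (real (Suc k) ^ 2)"
    have r0: "0 < r"
      using r(1) exp_gt_zero less_le_trans by blast
    have ln_r: "real k ^ 2 \<le> ln r" "ln r \<le> real (Suc k) ^ 2"
      using r ln_mono [OF r(2) r0] r0 by (simp_all add: ln_ge_iff del: of_nat_Suc)
    have k2: "0 < real k ^ 2"
      using k by simp
    obtain i where i: "k = Suc i"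
      using k by (cases k) auto
    define M where "M = max_modulus r canonical_product"
    have M: "M = norm (canonical_product (of_real r))"
      unfolding M_def using r0 by (intro max_modulus_canonical_product) simp
    have "exp (exp (\<rho> * real k ^ 2)) \<le> M"
      unfolding M i using r(1) right_end_le_left_end [of i k]
      by (intro canonical_product_growth_lower) (simp add: i left_end_def)
    then have M_pos: "0 < M" and lower1: "exp (\<rho> * real k ^ 2) \<le> ln M"
      using less_le_trans [OF exp_gt_zero] by (metis, metis ln_ge_iff)
    then have lnM: "0 < ln M" and lower: "\<rho> * real k ^ 2 \<le> ln (ln M)"
      using less_le_trans [OF exp_gt_zero] by (metis, metis ln_ge_iff)
    have "M \<le> exp (8 * (real k + 3) ^ 4 * target_degree k)"
      unfolding M using K [of "Suc k"] k r r0
      by (intro canonical_product_growth_upper) (auto simp: left_end_def)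
    then have "ln M \<le> 8 * (real k + 3) ^ 4 * target_degree k"
      using M_pos by (metis ln_exp ln_mono)
    then have "ln (ln M) \<le> ln (8 * (real k + 3) ^ 4 * target_degree k)"
      using lnM by (intro ln_mono)
    also have "\<dots> = ln 8 + 4 * ln (real k + 3) + \<rho> * real (Suc k) ^ 2 + 4 * ln (fact (k + 2))"
      by (simp add: target_degree_def ln_mult ln_realpow del: fact_Suc of_nat_Suc)
    also have "ln (fact (k + 2)) \<le> (real k + 2) * ln (real k + 2)"
    proof -
      have "(fact (k + 2) :: real) \<le> real (k + 2) ^ (k + 2)"
        using fact_le_power [of "k + 2", where 'a = real] unfolding of_nat_power .
      then have "ln (fact (k + 2)) \<le> ln (real (k + 2) ^ (k + 2))"
        using fact_gt_zero [of "k + 2", where 'a = real] by (intro ln_mono)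
      also have "\<dots> = real (k + 2) * ln (real (k + 2))"
        by (rule ln_realpow)
      also have "\<dots> = (real k + 2) * ln (real k + 2)"
        by (simp add: add.commute)
      finally show ?thesis .
    qed
    finally have upper: "ln (ln M) \<le> \<rho> * real (Suc k) ^ 2 + 4 * ((real k + 2) * ln (real k + 2))
      + ln 8 + 4 * ln (real k + 3)"
      by simp
    have nonneg: "0 \<le> \<rho> * real k ^ 2"
      using rho_nonneg by simp
    have "\<rho> * real k ^ 2 / real (Suc k) ^ 2 \<le> ln (ln M) / ln r"
      using lower ln_r nonneg k2 by (intro frac_le) linarith+
    moreover have "ln (ln M) / ln r \<le> u k"
      unfolding u_def using upper lower ln_r nonneg k2 by (intro frac_le) linarith+
    ultimately show "\<rho> * real k ^ 2 / real (Suc k) ^ 2 \<le> ln (ln M) / ln r \<and> ln (ln M) / ln r \<le> u k"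
      by blast
  next
    have "(\<lambda>k. \<rho> * (real k ^ 2 / real (Suc k) ^ 2)) \<longlonglongrightarrow> \<rho> * 1"
      by (intro tendsto_intros) real_asymp
    then show "(\<lambda>k. \<rho> * real k ^ 2 / real (Suc k) ^ 2) \<longlonglongrightarrow> \<rho>"
      by simp
  next
    have "(\<lambda>k. \<rho> * (real (Suc k) ^ 2 / real k ^ 2)
        + (4 * ((real k + 2) * ln (real k + 2)) + ln 8 + 4 * ln (real k + 3)) / real k ^ 2)
        \<longlonglongrightarrow> \<rho> * 1 + 0"
      by (intro tendsto_intros) real_asymp+
    then show "u \<longlonglongrightarrow> \<rho>"
      unfolding u_def by (simp add: add_divide_distrib add.assoc)
  qed
  then have "((\<lambda>r. ereal (ln (ln (max_modulus r canonical_product)) / ln r)) \<longlongrightarrow> ereal \<rho>) at_top"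
    by simp
  then show ?thesis
    unfolding growth_order_def by (intro lim_imp_Limsup) auto
qed

lemma log_mean_tendsto:
  "(log_mean {r. r > 0 \<and> min_on_circle r (log_abs canonical_product) > 0} \<longlongrightarrow> 1 - 2 * \<rho>) at_top"
proof -
  define S where "S = {r. r > 0 \<and> norm (canonical_product (- of_real r)) > 1}"
  have S: "{r. r > 0 \<and> min_on_circle r (log_abs canonical_product) > 0} = S"
    unfolding S_def using min_on_circle_canonical_product_pos_iff by auto
  define e where "e k = ln (16 * (real k + 3) ^ 4)" for k
  obtain K where K: "\<And>n j. n \<ge> K \<Longrightarrow> inverse_bound (j + n) \<le> inverse_bound n * (1 / 2) ^ j"
    using eventually_inverse_bound_halves by blast
  have exp_e: "exp (e k) = 16 * (real k + 3) ^ 4" for k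
    by (simp add: e_def)
  have e16: "16 \<le> exp (e k)" for k
    using one_le_power [of "real k + 3" 4] by (simp add: exp_e)
  show ?thesis
    unfolding S
  proof (rule log_mean_tendsto_of_gaps)
    show "S \<in> sets borel"
      unfolding S_def using open_large_minimum_modulus by (rule borel_open)
    show "S \<inter> {exp (real k ^ 2)..exp (real k ^ 2 + 2 * \<rho> * (2 * real k + 1))} = {}" for k
      using canonical_product_le_1_on_slit [of _ k]
      by (force simp: S_def left_end_def right_end_def)
    show "{exp (real k ^ 2 + 2 * \<rho> * (2 * real k + 1) + e k)..exp (real (Suc k) ^ 2 - e k)} \<subseteq> S"
      if "k \<ge> K" for k
    proof
      fix r assume r: "r \<in> {exp (real k ^ 2 + 2 * \<rho> * (2 * real k + 1) + e k)..exp (real (Suc k) ^ 2 - e k)}"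
      have "3 * right_end k \<le> right_end k * exp (e k)"
        using e16 [of k] by (simp add: right_end_def)
      also have "\<dots> \<le> r"
        using r by (simp add: right_end_def exp_add)
      finally have r1: "3 * right_end k \<le> r" .
      have "r \<le> left_end (Suc k) / exp (e k)"
        using r by (simp add: left_end_def exp_diff)
      then have r2: "r * (16 * (real k + 3) ^ 4) \<le> left_end (Suc k)"
        unfolding exp_e [symmetric] by (simp add: pos_le_divide_eq)
      have "0 < r"
        using r by (auto intro: less_le_trans [OF exp_gt_zero])
      moreover have "1 < norm (canonical_product (- of_real r))"
        using K [of "Suc k"] that r1 r2 by (intro canonical_product_gt_1_between_slits [of k]) auto
      ultimately show "r \<in> S"
        by (simp add: S_def)
    qed
    show "incseq e"
      unfolding e_def by (intro incseq_SucI ln_mono mult_left_mono power_mono) auto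
    show "0 < e k" for k
      using e16 [of k] by (smt (verit) exp_le_one_iff)
    show "(\<lambda>k. e k / real k) \<longlonglongrightarrow> 0"
      unfolding e_def by real_asymp
  qed (use rho_nonneg rho_less in auto)
qed

end

text \<open>
  The zeros are those of the normalised Chebyshev polynomials of the slits.
\<close>

lemma exists_slit_zeros_of_order:
  assumes "0 \<le> \<rho>" "\<rho> < 1 / 2"
  shows "\<exists>X. slit_zeros \<rho> X"
proof -
  interpret slit_parameters \<rho>
    by unfold_locales (use assms in auto)
  have "\<exists>xs. set xs \<subseteq> {left_end k..right_end k} \<and>
      target_degree k \<le> length xs \<and> length xs \<le> 2 * target_degree k \<and>
      (\<forall>r\<in>{left_end k..right_end k}. \<bar>\<Prod>x\<leftarrow>xs. 1 - r / x\<bar>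
          \<le> 2 * exp (- (length xs * exp (- (\<rho> * (2 * real k + 1)))))) \<and>
      (\<Sum>x\<leftarrow>xs. 1 / x) \<le> length xs * exp (- (real k ^ 2 + \<rho> * (2 * real k + 1)))" for k
  proof -
    obtain m where m: "target_degree k \<le> 2 ^ m" "2 ^ m \<le> 2 * target_degree k"
      using exists_power_of_two_between [OF target_degree_ge_1] by blast
    have sqrt_exp: "sqrt (exp t) = exp (t / 2)" for t :: real
      by (rule real_sqrt_unique) (simp_all add: power2_eq_square flip: exp_add)
    have ratio: "sqrt (left_end k / right_end k) = exp (- (\<rho> * (2 * real k + 1)))"
      unfolding left_end_def right_end_def exp_diff [symmetric] sqrt_exp by simp
    have product: "sqrt (left_end k * right_end k) = exp (real k ^ 2 + \<rho> * (2 * real k + 1))"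
      unfolding left_end_def right_end_def exp_add [symmetric] sqrt_exp by simp
    have quotient: "2 ^ m / exp t = 2 ^ m * exp (- t)" for t :: real
      by (simp add: exp_minus divide_inverse)
    obtain xs where "length xs = 2 ^ m" "set xs \<subseteq> {left_end k..right_end k}"
      "\<forall>r\<in>{left_end k..right_end k}. \<bar>\<Prod>x\<leftarrow>xs. 1 - r / x\<bar>
          \<le> 2 * exp (- (2 ^ m * exp (- (\<rho> * (2 * real k + 1)))))"
      "(\<Sum>x\<leftarrow>xs. 1 / x) \<le> 2 ^ m * exp (- (real k ^ 2 + \<rho> * (2 * real k + 1)))"
      using exists_slit_zeros [of "left_end k" "right_end k" m] left_end_le_right_end [of k]
      unfolding ratio product quotient by (auto simp: left_end_def)
    then show ?thesis
      using m by (intro exI [of _ xs]) simp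
  qed
  then obtain X where X: "\<And>k. set (X k) \<subseteq> {left_end k..right_end k} \<and>
      target_degree k \<le> length (X k) \<and> length (X k) \<le> 2 * target_degree k \<and>
      (\<forall>r\<in>{left_end k..right_end k}. \<bar>\<Prod>x\<leftarrow>X k. 1 - r / x\<bar>
          \<le> 2 * exp (- (length (X k) * exp (- (\<rho> * (2 * real k + 1)))))) \<and>
      (\<Sum>x\<leftarrow>X k. 1 / x) \<le> length (X k) * exp (- (real k ^ 2 + \<rho> * (2 * real k + 1)))"
    by metis
  have "slit_zeros \<rho> X"
    by unfold_locales (use X in blast)+
  then show ?thesis
    by blast
qed

theorem corollary1p7:
  fixes \<rho> :: real
  assumes "0 \<le> \<rho>" and "\<rho> < 1 / 2"
  shows "\<exists>f. transcendental_entire f \<and> growth_order f = ereal \<rho> \<and>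
           lower_log_density {r. r > 0 \<and> min_on_circle r (log_abs f) > 0} = ereal (1 - 2 * \<rho>) \<and>
           upper_log_density {r. r > 0 \<and> min_on_circle r (log_abs f) > 0} = ereal (1 - 2 * \<rho>)"
proof -
  obtain X where "slit_zeros \<rho> X"
    using exists_slit_zeros_of_order assms by blast
  then interpret slit_zeros \<rho> X .
  have "((\<lambda>R. ereal (log_mean {r. r > 0 \<and> min_on_circle r (log_abs canonical_product) > 0} R))
      \<longlongrightarrow> ereal (1 - 2 * \<rho>)) at_top"
    using log_mean_tendsto by simp
  then show ?thesis
    using transcendental growth_order_eq
    by (intro exI [of _ canonical_product])
      (auto simp: lower_log_density_def upper_log_density_def intro!: lim_imp_Limsup lim_imp_Liminf)
qed

end
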